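(* Let $m,n$ be positive integers, $K=J(2m,2n)$, $\xi=e^{2\pi\sqrt{-1}/(4mn-1)}$, and for $1\le i\le 2mn-1$ let $\rho_i\colon\pi_1(E_K)\to\mathrm{SL}_2(\mathbb{C})$ be the irreducible metabelian representation given by \[ \rho_i(x_1)=\begin{bmatrix}\xi^i&0\\0&\xi^{-i}\end{bmatrix},\quad \rho_i(x_2)=\begin{bmatrix}\xi^{2mi}&0\\0&\xi^{-2mi}\end{bmatrix},\quad \rho_i(\mu)=\begin{bmatrix}0&1\\-1&0\end{bmatrix}. \] Set $q_i=\frac{4mn-1}{\gcd(4mn-1,i)}$ and $(\rho_i)_{2N}=\sigma_{2N}\circ\rho_i$. Then \[ \lim_{N\to\infty}\frac{\log\Delta_{J(2m,2n),(\rho_i)_{2N}}(t)}{2N}=\frac{1}{2q_i}\log\frac{m^2n^2t^4+(2m^2n^2-4mn+1)t^2+m^2n^2}{(t^2+1)^2}+\frac12\log(t^2+1). \]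
   Context: $J(2m,2n)$ is the double twist knot (a genus one two-bridge knot) in Hoste--Shanahan's notation. Its exterior $E_K=S^3\setminus N(K)$, with $N(K)$ an open tubular neighbourhood, has fundamental group with the Lin presentation (associated with a genus one free Seifert surface) \[ \pi_1(E_K)=\langle x_1,x_2,\mu\mid \mu x_1^m\mu^{-1}=x_1^mx_2^{-1},\ \mu x_2^{-n}x_1\mu^{-1}=x_2^{-n}\rangle, \] where $\mu$ is a meridian. The abelianization $\alpha\colon\pi_1(E_K)\to\langle t\rangle$ satisfies $\alpha(x_1)=\alpha(x_2)=1$, $\alpha(\mu)=t$. The $\rho_i$, $1\le i\le 2mn-1$, represent all irreducible metabelian $\mathrm{SL}_2(\mathbb{C})$-representations of $\pi_1(E_K)$ up to conjugation (metabelian: the commutator subgroup has abelian image). $\sigma_n\colon\mathrm{SL}_2(\mathbb{C})\to\mathrm{SL}_n(\mathbb{C})$ is the $n$-dimensional irreducible representation, given by the action on the space of homogeneous polynomials $p(x,y)$ of degree $n-1$: $A\cdot p(x,y)=p(x',y')$ with $\binom{x'}{y'}=A^{-1}\binom{x}{y}$. Twisted Alexander polynomial: for $\varphi\colon\pi_1(E_K)\to\mathrm{SL}_d(\mathbb{C})$ with $d$ even let $\Phi_\varphi\colon\mathbb{Z}[\pi_1(E_K)]\to M_d(\mathbb{C}[t^{\pm1}])$ be the $\mathbb{Z}$-linear extension of $\gamma\mapsto\alpha(\gamma)\varphi(\gamma)$. With $r_1=\mu x_1^m\mu^{-1}x_2x_1^{-m}$ and $r_2=\mu x_2^{-n}x_1\mu^{-1}x_2^{n}$,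 \[ \Delta_{K,\varphi}(t)=\frac{\det\big(\Phi_\varphi(\partial r_k/\partial x_l)\big)_{1\le k,l\le2}}{\det\Phi_\varphi(1-\mu)}, \] where $\partial r_k/\partial x_l$ are Fox derivatives. *)

theory Defs
  imports
    "HOL-Library.Poly_Mapping"
    "HOL-Algebra.Generated_Groups"
    "HOL-Computational_Algebra.Normalized_Fraction"
    "HOL-Computational_Algebra.Field_as_Ring"
    "HOL-Analysis.Complex_Transcendental"
    "Jordan_Normal_Form.Determinant"
    "Jordan_Normal_Form.VS_Connect"
begin

text \<open>A letter \<open>(g, True)\<close> stands for the generator
  \<open>g\<close>, \<open>(g, False)\<close> for its inverse.\<close>

type_synonym 'a word = "('a \<times> bool) list"

definition gpow :: "'a \<Rightarrow> int \<Rightarrow> 'a word" where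
  "gpow g k = replicate (nat \<bar>k\<bar>) (g, 0 \<le> k)"

inductive word_eq :: "'a word set \<Rightarrow> 'a word \<Rightarrow> 'a word \<Rightarrow> bool" for R where
  refl: "word_eq R u u"
| sym: "word_eq R u v \<Longrightarrow> word_eq R v u"
| trans: "word_eq R u v \<Longrightarrow> word_eq R v w \<Longrightarrow> word_eq R u w"
| cancel: "word_eq R (u @ [(g, e), (g, \<not> e)] @ v) (u @ v)"
| relator: "r \<in> R \<Longrightarrow> word_eq R (u @ r @ v) (u @ v)"

definition word_class :: "'a word set \<Rightarrow> 'a word \<Rightarrow> 'a word set" where
  "word_class R w = {v. word_eq R w v}"

definition presented_group :: "'a word set \<Rightarrow> 'a word set monoid" where
  "presented_group R =
     \<lparr>carrier = UNIV // {(u, v). word_eq R u v},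
      monoid.mult = (\<lambda>A B. \<Union>u\<in>A. \<Union>v\<in>B. word_class R (u @ v)),
      monoid.one = word_class R []\<rparr>"

definition group_gen :: "'a word set \<Rightarrow> 'a \<Rightarrow> 'a word set" where
  "group_gen R g = word_class R [(g, True)]"

abbreviation free_group :: "'a word set monoid" where
  "free_group \<equiv> presented_group {}"

definition free_proj :: "'a word set \<Rightarrow> 'a word set \<Rightarrow> 'a word set" where
  "free_proj R A = (\<Union>w\<in>A. word_class R w)"

text \<open>The additive group of the integral group ring of \<open>G\<close> is the free abelian group
  \<open>'g \<Rightarrow>\<^sub>0 int\<close>, \<open>frag_of g\<close> being the element \<open>g\<close>; below only elements supported in the
  carrier of \<open>G\<close> occur.\<close>

definition gring_lmult :: "('g, 'b) monoid_scheme \<Rightarrow> 'g \<Rightarrow> ('g \<Rightarrow>\<^sub>0 int) \<Rightarrow> ('g \<Rightarrow>\<^sub>0 int)" where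
  "gring_lmult G g a = frag_extend (\<lambda>h. frag_of (g \<otimes>\<^bsub>G\<^esub> h)) a"

definition gring_map :: "('g \<Rightarrow> 'h) \<Rightarrow> ('g \<Rightarrow>\<^sub>0 int) \<Rightarrow> ('h \<Rightarrow>\<^sub>0 int)" where
  "gring_map f a = frag_extend (\<lambda>h. frag_of (f h)) a"

text \<open>Fox derivative, with values in the group ring of the free group: it is the map with
  \<open>\<partial>(u v) = \<partial>u + u \<partial>v\<close>, \<open>\<partial>x/\<partial>x = 1\<close>, \<open>\<partial>x\<^sup>-\<^sup>1/\<partial>x = - x\<^sup>-\<^sup>1\<close> and \<open>\<partial>g/\<partial>x = 0\<close> for the other
  generators \<open>g\<close>.\<close>

fun fox :: "'a \<Rightarrow> 'a word \<Rightarrow> 'a word set \<Rightarrow>\<^sub>0 int" where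
  "fox x [] = 0"
| "fox x ((g, e) # w) =
     (if g \<noteq> x then 0
      else if e then frag_of \<one>\<^bsub>free_group\<^esub>
      else - frag_of (word_class {} [(g, False)]))
     + gring_lmult free_group (word_class {} [(g, e)]) (fox x w)"

text \<open>The fundamental group of the exterior of the double twist knot \<open>J(2m,2n)\<close> enters through the
  Lin presentation (from a free Seifert surface of genus one), with relations
  \<open>\<mu> x\<^sub>1\<^sup>m \<mu>\<^sup>-\<^sup>1 = x\<^sub>1\<^sup>m x\<^sub>2\<^sup>-\<^sup>1\<close> and \<open>\<mu> x\<^sub>2\<^sup>-\<^sup>n x\<^sub>1 \<mu>\<^sup>-\<^sup>1 = x\<^sub>2\<^sup>-\<^sup>n\<close>; the relators below are left side
  times inverse of right side.\<close>

datatype gen = X1 | X2 | Mu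

definition lin_r1 :: "nat \<Rightarrow> gen word" where
  "lin_r1 m = gpow Mu 1 @ gpow X1 (int m) @ gpow Mu (-1) @ gpow X2 1 @ gpow X1 (- int m)"

definition lin_r2 :: "nat \<Rightarrow> gen word" where
  "lin_r2 n = gpow Mu 1 @ gpow X2 (- int n) @ gpow X1 1 @ gpow Mu (-1) @ gpow X2 (int n)"

definition lin_relators :: "nat \<Rightarrow> nat \<Rightarrow> gen word set" where
  "lin_relators m n = {lin_r1 m, lin_r2 n}"

definition knot_group :: "nat \<Rightarrow> nat \<Rightarrow> gen word set monoid" where
  "knot_group m n = presented_group (lin_relators m n)"

definition knot_gen :: "nat \<Rightarrow> nat \<Rightarrow> gen \<Rightarrow> gen word set" where
  "knot_gen m n g = group_gen (lin_relators m n) g"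

text \<open>The abelianization, \<open>t\<^sup>k\<close> being recorded as \<open>k\<close>.  The exponent sum in \<open>\<mu>\<close> is constant on
  each element of the group, since it vanishes on both relators.\<close>

definition mu_exponent :: "gen word \<Rightarrow> int" where
  "mu_exponent w = (\<Sum>(g, e)\<leftarrow>w. if g = Mu then (if e then 1 else -1) else 0)"

definition alpha :: "gen word set \<Rightarrow> int" where
  "alpha A = the_elem (mu_exponent ` A)"

definition SL :: "nat \<Rightarrow> complex mat monoid" where
  "SL d = \<lparr>carrier = {A \<in> carrier_mat d d. det A = 1}, monoid.mult = (*), monoid.one = 1\<^sub>m d\<rparr>"

definition irreducible_rep :: "('g, 'b) monoid_scheme \<Rightarrow> nat \<Rightarrow> ('g \<Rightarrow> complex mat) \<Rightarrow> bool" where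
  "irreducible_rep G d \<phi> \<longleftrightarrow> 0 < d \<and>
     (\<forall>W. VectorSpace.subspace class_ring W (module_vec TYPE(complex) d) \<longrightarrow>
          (\<forall>g\<in>carrier G. \<forall>v\<in>W. \<phi> g *\<^sub>v v \<in> W) \<longrightarrow>
          W = {0\<^sub>v d} \<or> W = carrier_vec d)"

definition metabelian_rep :: "('g, 'b) monoid_scheme \<Rightarrow> ('g \<Rightarrow> complex mat) \<Rightarrow> bool" where
  "metabelian_rep G \<phi> \<longleftrightarrow>
     (\<forall>a\<in>derived G (carrier G). \<forall>b\<in>derived G (carrier G). \<phi> a * \<phi> b = \<phi> b * \<phi> a)"

text \<open>Polynomials in two variables are elements of \<open>complex poly poly\<close>; the outer variable is
  \<open>y\<close>, the inner one \<open>x\<close>.\<close>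

definition var_x :: "complex poly poly" where "var_x = [:[:0, 1:]:]"

definition var_y :: "complex poly poly" where "var_y = [:0, 1:]"

definition const2 :: "complex \<Rightarrow> complex poly poly" where "const2 c = [:[:c:]:]"

definition coeff_xy :: "complex poly poly \<Rightarrow> nat \<Rightarrow> nat \<Rightarrow> complex" where
  "coeff_xy p j k = coeff (coeff p k) j"

definition subst_xy ::
  "complex poly poly \<Rightarrow> complex poly poly \<Rightarrow> complex poly poly \<Rightarrow> complex poly poly" where
  "subst_xy p u v =
     (\<Sum>k\<le>degree p. \<Sum>j\<le>degree (coeff p k). const2 (coeff_xy p j k) * u ^ j * v ^ k)"

definition SL2_act :: "complex mat \<Rightarrow> complex poly poly \<Rightarrow> complex poly poly" where
  "SL2_act A p = (let B = inv\<^bsub>SL 2\<^esub> A in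
     subst_xy p (const2 (B $$ (0, 0)) * var_x + const2 (B $$ (0, 1)) * var_y)
                (const2 (B $$ (1, 0)) * var_x + const2 (B $$ (1, 1)) * var_y))"

text \<open>The matrix of the action on homogeneous polynomials of degree \<open>d - 1\<close> in the basis
  \<open>x\<^sup>j y\<^sup>d\<^sup>-\<^sup>1\<^sup>-\<^sup>j\<close>, \<open>0 \<le> j < d\<close>: the \<open>j\<close>-th column is the image of the \<open>j\<close>-th basis vector.\<close>

definition sigma :: "nat \<Rightarrow> complex mat \<Rightarrow> complex mat" where
  "sigma d A = mat d d (\<lambda>(i, j).
     coeff_xy (SL2_act A (var_x ^ j * var_y ^ (d - 1 - j))) i (d - 1 - i))"

text \<open>The ring of Laurent polynomials in \<open>t\<close> is regarded as a subring of the field of rational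
  functions.  Evaluation uses the fraction in lowest terms, so it is the value of the rational
  function wherever that function has no pole.\<close>

type_synonym ratfun = "complex poly fract"

definition rf_const :: "complex \<Rightarrow> ratfun" where "rf_const c = to_fract [:c:]"

definition rf_t :: ratfun where "rf_t = to_fract [:0, 1:]"

definition rf_eval :: "ratfun \<Rightarrow> complex \<Rightarrow> complex" where
  "rf_eval r z = poly (fst (quot_of_fract r)) z / poly (snd (quot_of_fract r)) z"

definition Phi :: "nat \<Rightarrow> (gen word set \<Rightarrow> complex mat) \<Rightarrow> (gen word set \<Rightarrow>\<^sub>0 int) \<Rightarrow> ratfun mat" where
  "Phi d \<phi> a = mat d d (\<lambda>(i, j). \<Sum>\<gamma>\<in>Poly_Mapping.keys a.
     of_int (Poly_Mapping.lookup a \<gamma>) * rf_t powi (alpha \<gamma>) * rf_const (\<phi> \<gamma> $$ (i, j)))"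

definition knot_fox :: "nat \<Rightarrow> nat \<Rightarrow> gen word \<Rightarrow> gen \<Rightarrow> gen word set \<Rightarrow>\<^sub>0 int" where
  "knot_fox m n r x = gring_map (free_proj (lin_relators m n)) (fox x r)"

definition twisted_alexander ::
  "nat \<Rightarrow> nat \<Rightarrow> nat \<Rightarrow> (gen word set \<Rightarrow> complex mat) \<Rightarrow> ratfun" where
  "twisted_alexander m n d \<phi> =
     det (four_block_mat
            (Phi d \<phi> (knot_fox m n (lin_r1 m) X1)) (Phi d \<phi> (knot_fox m n (lin_r1 m) X2))
            (Phi d \<phi> (knot_fox m n (lin_r2 n) X1)) (Phi d \<phi> (knot_fox m n (lin_r2 n) X2)))
     / det (Phi d \<phi> (frag_of \<one>\<^bsub>knot_group m n\<^esub> - frag_of (knot_gen m n Mu)))"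

end

theory Submission
  imports Defs "HOL-Number_Theory.Cong"
begin

text \<open>On the even-dimensional representation \<open>\<sigma>\<^sub>2\<^sub>N\<close> the images of \<open>x\<^sub>1\<close> and \<open>x\<^sub>2\<close> are diagonal and
  that of \<open>\<mu>\<close> is antidiagonal, so \<open>\<sigma>\<^sub>2\<^sub>N \<circ> \<rho>\<close> splits into \<open>N\<close> two-dimensional pieces, indexed by the
  odd weights \<open>k = 1, 3, \<dots>, 2N - 1\<close>, on which \<open>x\<^sub>1\<close> acts with eigenvalue \<open>\<eta> = \<xi>\<^sup>i\<^sup>k\<close>.  The denominator
  contributes \<open>1 + t\<^sup>2\<close> for each piece.  The numerator contributes
  \<open>m\<^sup>2n\<^sup>2(1 - t\<^sup>2)\<^sup>2 + t\<^sup>2(2mn - 1)\<^sup>2\<close> if \<open>\<eta> = 1\<close>, that is if \<open>q\<close> divides \<open>k\<close>, and \<open>c\<^sub>k(1 + t\<^sup>2)\<^sup>2\<close> otherwise,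
  where \<open>c\<^sub>k\<close> is the square of
  \<open>\<bar>1 - \<eta>\<^sup>m\<bar> \<bar>1 - \<eta>\<^sup>2\<^sup>m\<^sup>n\<bar> / (\<bar>1 - \<eta>\<bar> \<bar>1 - \<eta>\<^sup>2\<^sup>m\<bar>)\<close>.
  Everything is periodic in \<open>k\<close>, so the limit is a mean over one period; there the \<open>c\<^sub>k\<close> cancel,
  because multiplication by \<open>1\<close>, \<open>m\<close>, \<open>2m\<close> and \<open>2mn\<close> permutes the residues modulo the odd number \<open>q\<close>.\<close>

section \<open>Presented groups and Fox derivatives\<close>

lemma word_eq_append_cong:
  assumes "word_eq R u v"
  shows "word_eq R (x @ u @ y) (x @ v @ y)"
  using assms
proof induction
  case (cancel u g e v)
  show ?case using word_eq.cancel[of R "x @ u" g e "v @ y"] by simp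
next
  case (relator r u v)
  then show ?case using word_eq.relator[of r R "x @ u" "v @ y"] by simp
qed (blast intro: word_eq.refl word_eq.sym word_eq.trans)+

lemma word_eq_append:
  assumes "word_eq R u u'" "word_eq R v v'"
  shows "word_eq R (u @ v) (u' @ v')"
  using word_eq_append_cong[OF assms(1), of "[]" v] word_eq_append_cong[OF assms(2), of u' "[]"]
  by (auto intro: word_eq.trans)

lemma word_eq_mono: "word_eq R u v \<Longrightarrow> R \<subseteq> S \<Longrightarrow> word_eq S u v"
proof (induction rule: word_eq.induct)
  case (cancel u g e v)
  show ?case by (rule word_eq.cancel)
qed (blast intro: word_eq.refl word_eq.sym word_eq.trans word_eq.relator)+

lemma word_class_eqI: "word_eq R u v \<Longrightarrow> word_class R u = word_class R v"
  unfolding word_class_def by (blast intro: word_eq.sym word_eq.trans)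

lemma word_class_self [simp]: "w \<in> word_class R w"
  by (simp add: word_class_def word_eq.refl)

lemma word_class_nonempty [simp]: "word_class R w \<noteq> {}"
  using word_class_self by blast

lemma word_class_in_carrier [simp]: "word_class R w \<in> carrier (presented_group R)"
  by (auto simp: presented_group_def word_class_def quotient_def)

text \<open>Equivalence of words is a congruence, so every choice of representatives yields the same
  class. Classes are nonempty, so the double union collapses to that class.\<close>

lemma word_class_mult [simp]:
  "word_class R u \<otimes>\<^bsub>presented_group R\<^esub> word_class R v = word_class R (u @ v)"
proof -
  have *: "word_class R (u' @ v') = word_class R (u @ v)"
    if "u' \<in> word_class R u" "v' \<in> word_class R v" for u' v'
    using that by (intro word_class_eqI word_eq.sym[OF word_eq_append]) (simp_all add: word_class_def)
  have "(\<Union>u'\<in>word_class R u. \<Union>v'\<in>word_class R v. word_class R (u' @ v'))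
      = (\<Union>u'\<in>word_class R u. \<Union>v'\<in>word_class R v. word_class R (u @ v))"
    by (rule SUP_cong[OF HOL.refl SUP_cong[OF HOL.refl *]])
  also have "\<dots> = word_class R (u @ v)"
    by (simp add: UN_constant word_class_nonempty)
  finally show ?thesis by (simp add: presented_group_def)
qed

lemma word_class_one: "\<one>\<^bsub>presented_group R\<^esub> = word_class R []"
  by (simp add: presented_group_def)

text \<open>Free equivalence implies equivalence modulo \<open>R\<close>, so all words of a free
  class project to one class.\<close>

lemma free_proj_word_class [simp]: "free_proj R (word_class {} w) = word_class R w"
proof -
  have "word_class R v = word_class R w" if "v \<in> word_class {} w" for v
    using that word_eq.sym[OF word_eq_mono[of "{}" w v R]]
    by (intro word_class_eqI) (simp add: word_class_def)
  then show ?thesis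
    using word_class_self[of w "{}"] unfolding free_proj_def by blast
qed

lemma word_class_cancel: "word_class R ((g, e) # (g, \<not> e) # w) = word_class R w"
  using word_eq.cancel[of R "[]" g e w] by (intro word_class_eqI) simp

section \<open>Additive maps out of the integral group ring, and Fox derivatives seen through
  them\<close>

definition int_linear :: "('g \<Rightarrow> 'r::ring_1) \<Rightarrow> ('g \<Rightarrow>\<^sub>0 int) \<Rightarrow> 'r" where
  "int_linear f a = (\<Sum>g\<in>Poly_Mapping.keys a. of_int (Poly_Mapping.lookup a g) * f g)"

text \<open>Cancellation can shrink the support of a difference, so additivity is proved with sums
  over a common superset of the supports.\<close>

lemma int_linear_superset:
  assumes "finite S" "Poly_Mapping.keys a \<subseteq> S"
  shows "int_linear f a = (\<Sum>g\<in>S. of_int (Poly_Mapping.lookup a g) * f g)"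
  unfolding int_linear_def
  by (rule sum.mono_neutral_left) (use assms in \<open>auto simp: in_keys_iff\<close>)

lemma int_linear_diff: "int_linear f (a - b) = int_linear f a - int_linear f b"
proof -
  let ?S = "Poly_Mapping.keys a \<union> Poly_Mapping.keys b"
  have "Poly_Mapping.keys (a - b) \<subseteq> ?S" by (rule keys_diff)
  then show ?thesis
    by (simp add: int_linear_superset[of ?S] lookup_minus sum_subtractf left_diff_distrib)
qed

lemma int_linear_0 [simp]: "int_linear f 0 = 0"
  by (simp add: int_linear_def)

lemma int_linear_uminus: "int_linear f (- a) = - int_linear f a"
  using int_linear_diff[of f 0 a] by simp

lemma int_linear_add: "int_linear f (a + b) = int_linear f a + int_linear f b"
  using int_linear_diff[of f a "- b"] by (simp add: int_linear_uminus)

lemma int_linear_frag_of [simp]: "int_linear f (frag_of g) = f g"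
  by (simp add: int_linear_def keys_frag_of)

lemma int_linear_gring_map: "int_linear f (gring_map h a) = int_linear (\<lambda>g. f (h g)) a"
proof -
  have "Poly_Mapping.keys a \<subseteq> UNIV" by simp
  then show ?thesis
  proof (induction a rule: frag_induction)
    case (diff a b)
  then show ?case
    by (simp add: gring_map_def frag_extend_diff int_linear_diff)
  qed (simp_all add: gring_map_def)
qed

lemma int_linear_gring_lmult:
  "int_linear f (gring_lmult G g a) = int_linear (\<lambda>h. f (g \<otimes>\<^bsub>G\<^esub> h)) a"
  using int_linear_gring_map[of f "\<lambda>h. g \<otimes>\<^bsub>G\<^esub> h" a]
  by (simp add: gring_lmult_def gring_map_def)

text \<open>The Fox derivative followed by the additive map sending a word \<open>v\<close> to \<open>F v\<close>.\<close>

fun fox_sum :: "'a \<Rightarrow> 'a word \<Rightarrow> ('a word \<Rightarrow> 'r::ring_1) \<Rightarrow> 'r" where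
  "fox_sum x [] F = 0"
| "fox_sum x ((g, e) # w) F =
     (if g \<noteq> x then 0 else if e then F [] else - F [(g, False)])
     + fox_sum x w (\<lambda>v. F ((g, e) # v))"

text \<open>Passing the first letter replaces \<open>f\<close> by its left translate, so the
  induction ranges over all \<open>f\<close>.\<close>

lemma int_linear_fox:
  "int_linear f (fox x w) = fox_sum x w (\<lambda>v. f (word_class {} v))"
proof (induction x w arbitrary: f rule: fox.induct)
  case (2 x g e w)
  show ?case
    by (auto simp: int_linear_add int_linear_uminus int_linear_gring_lmult 2 word_class_one)
qed simp

lemma int_linear_knot_fox:
  "int_linear f (knot_fox m n r x) = fox_sum x r (\<lambda>v. f (word_class (lin_relators m n) v))"
  by (simp add: knot_fox_def int_linear_gring_map int_linear_fox)

lemma fox_sum_append: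
  "fox_sum x (u @ w) F = fox_sum x u F + fox_sum x w (\<lambda>v. F (u @ v))"
  by (induction x u F rule: fox_sum.induct) (auto simp: add.assoc)

lemma fox_sum_replicate_other: "g \<noteq> x \<Longrightarrow> fox_sum x (replicate k (g, e)) F = 0"
  by (induction k arbitrary: F) auto

lemma fox_sum_replicate_pos:
  "fox_sum x (replicate k (x, True)) F = (\<Sum>a<k. F (replicate a (x, True)))"
  by (induction k arbitrary: F) (simp_all del: sum.lessThan_Suc add: sum.lessThan_Suc_shift)

text \<open>The derivative of an inverse letter contains that letter, so the exponents run from 1 to
  \<open>k\<close>, not from 0 to \<open>k - 1\<close> as for positive powers.\<close>

lemma fox_sum_replicate_neg:
  "fox_sum x (replicate k (x, False)) F = - (\<Sum>a<k. F (replicate (Suc a) (x, False)))"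
  by (induction k arbitrary: F) (simp_all del: sum.lessThan_Suc add: sum.lessThan_Suc_shift)

section \<open>The abelianization and the entries of \<open>Phi\<close>\<close>

lemma mu_exponent_append [simp]: "mu_exponent (u @ v) = mu_exponent u + mu_exponent v"
  by (simp add: mu_exponent_def)

lemma mu_exponent_Nil [simp]: "mu_exponent [] = 0"
  by (simp add: mu_exponent_def)

lemma mu_exponent_Cons [simp]:
  "mu_exponent ((g, e) # w) = (if g = Mu then (if e then 1 else -1) else 0) + mu_exponent w"
  by (simp add: mu_exponent_def)

lemma mu_exponent_replicate [simp]:
  "mu_exponent (replicate k (g, e)) = int k * mu_exponent [(g, e)]"
  by (induction k) (auto simp: algebra_simps)

lemma mu_exponent_word_eq:
  assumes "word_eq (lin_relators m n) u v"
  shows "mu_exponent u = mu_exponent v"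
  using assms
proof induction
  case (relator r u v)
  then show ?case
    by (auto simp: lin_relators_def lin_r1_def lin_r2_def gpow_def)
qed auto

lemma alpha_word_class [simp]: "alpha (word_class (lin_relators m n) w) = mu_exponent w"
proof -
  have "mu_exponent v = mu_exponent w" if "v \<in> word_class (lin_relators m n) w" for v
    using that mu_exponent_word_eq[of m n w v] by (simp add: word_class_def)
  then have "mu_exponent ` word_class (lin_relators m n) w = {mu_exponent w}"
    using word_class_self[of w "lin_relators m n"] by blast
  then show ?thesis by (simp add: alpha_def)
qed

lemma Phi_index:
  assumes "i < d" "j < d"
  shows "Phi d \<phi> a $$ (i, j) =
    int_linear (\<lambda>\<gamma>. rf_t powi (alpha \<gamma>) * rf_const (\<phi> \<gamma> $$ (i, j))) a"
  using assms by (simp add: Phi_def int_linear_def mult.assoc)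

section \<open>Matrices supported on the diagonal and the antidiagonal\<close>

text \<open>Such a matrix is a direct sum of \<open>N\<close> blocks of size two, on the index pairs
  \<open>i\<close>, \<open>2 * N - 1 - i\<close>. The even size keeps the two diagonals disjoint;
  \<open>r\<close> is indexed by row.\<close>

definition cross :: "nat \<Rightarrow> (nat \<Rightarrow> 'a::zero) \<Rightarrow> (nat \<Rightarrow> 'a) \<Rightarrow> 'a mat" where
  "cross N p r = mat (2 * N) (2 * N)
     (\<lambda>(i, j). if i = j then p i else if i + j = 2 * N - 1 then r i else 0)"

lemma cross_carrier [simp]: "cross N p r \<in> carrier_mat (2 * N) (2 * N)"
  by (simp add: cross_def)

lemma cross_dim [simp]: "dim_row (cross N p r) = 2 * N" "dim_col (cross N p r) = 2 * N"
  by (simp_all add: cross_def)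

lemma cross_index:
  "i < 2 * N \<Longrightarrow> j < 2 * N \<Longrightarrow>
     cross N p r $$ (i, j) = (if i = j then p i else if i + j = 2 * N - 1 then r i else 0)"
  by (simp add: cross_def)

lemma cross_cong:
  "(\<And>i. i < 2 * N \<Longrightarrow> p i = p' i) \<Longrightarrow> (\<And>i. i < 2 * N \<Longrightarrow> r i = r' i) \<Longrightarrow> cross N p r = cross N p' r'"
  by (auto simp: cross_def intro!: eq_matI)

text \<open>Row \<open>i\<close> of the left factor lives in the columns \<open>i\<close> and
  \<open>2 * N - 1 - i\<close>, so this is multiplication of two-by-two blocks.\<close>

lemma cross_mult:
  fixes p r p' r' :: "nat \<Rightarrow> 'a::comm_ring_1"
  shows "cross N p r * cross N p' r' =
    cross N (\<lambda>i. p i * p' i + r i * r' (2 * N - 1 - i)) (\<lambda>i. p i * r' i + r i * p' (2 * N - 1 - i))"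
proof (rule eq_matI)
  fix i j assume "i < dim_row (cross N (\<lambda>i. p i * p' i + r i * r' (2 * N - 1 - i))
      (\<lambda>i. p i * r' i + r i * p' (2 * N - 1 - i)))"
    and "j < dim_col (cross N (\<lambda>i. p i * p' i + r i * r' (2 * N - 1 - i))
      (\<lambda>i. p i * r' i + r i * p' (2 * N - 1 - i)))"
  then have ij: "i < 2 * N" "j < 2 * N" by simp_all
  let ?i = "2 * N - 1 - i"
  have ne: "i \<noteq> ?i" and li: "?i < 2 * N" using ij by presburger+
  have "(cross N p r * cross N p' r') $$ (i, j)
      = (\<Sum>k\<in>{0..<2 * N}. cross N p r $$ (i, k) * cross N p' r' $$ (k, j))"
    using ij by (simp add: scalar_prod_def)
  also have "\<dots> = (\<Sum>k\<in>{i, ?i}. cross N p r $$ (i, k) * cross N p' r' $$ (k, j))"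
    by (rule sum.mono_neutral_right) (use ij li in \<open>auto simp: cross_index\<close>)
  also have "\<dots> = p i * cross N p' r' $$ (i, j) + r i * cross N p' r' $$ (?i, j)"
    using ne li ij by (simp add: cross_index)
  also have "\<dots> = cross N (\<lambda>i. p i * p' i + r i * r' (2 * N - 1 - i))
      (\<lambda>i. p i * r' i + r i * p' (2 * N - 1 - i)) $$ (i, j)"
  proof -
    have "cross N p' r' $$ (?i, j) = (if i + j = 2 * N - 1 then p' ?i else if i = j then r' ?i else 0)"
    proof -
      have "?i = j \<longleftrightarrow> i + j = 2 * N - 1" using ij by linarith
      moreover have "?i + j = 2 * N - 1 \<longleftrightarrow> i = j" using ij by linarith
      ultimately show ?thesis unfolding cross_index[OF li ij(2)] by simp
    qed
    moreover have "i = j \<Longrightarrow> i + j \<noteq> 2 * N - 1" using ne ij by simp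
    ultimately show ?thesis
      unfolding cross_index[OF ij] by (cases "i = j"; cases "i + j = 2 * N - 1") simp_all
  qed
  finally show "(cross N p r * cross N p' r') $$ (i, j) = \<dots>" .
qed simp_all

lemma cross_minus:
  fixes p r p' r' :: "nat \<Rightarrow> 'a::ab_group_add"
  shows "cross N p r - cross N p' r' = cross N (\<lambda>i. p i - p' i) (\<lambda>i. r i - r' i)"
  by (rule eq_matI) (auto simp: cross_index)

lemma cross_one: "1\<^sub>m (2 * N) = cross N (\<lambda>_. 1) (\<lambda>_. 0)"
  by (rule eq_matI) (auto simp: cross_index)

lemma det_diagonal:
  "det (mat N N (\<lambda>(i, j). if i = j then p i else 0)) = (\<Prod>i<N. p i :: 'a::idom)"
proof -
  have "det (mat N N (\<lambda>(i, j). if i = j then p i else 0))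
      = prod_list (diag_mat (mat N N (\<lambda>(i, j). if i = j then p i else 0)))"
    by (rule det_upper_triangular[of _ N]) (auto simp: upper_triangular_def)
  also have "\<dots> = prod_list (map p [0..<N])"
    by (rule arg_cong[of _ _ prod_list]) (auto simp: diag_mat_def)
  also have "\<dots> = (\<Prod>i<N. p i)"
    by (simp add: prod.list_conv_set_nth atLeast0LessThan)
  finally show ?thesis .
qed

text \<open>Reversing the second half of the indices turns the matrix into four diagonal square
  blocks. These commute, so the block determinant formula applies and leaves a diagonal
  matrix.\<close>

lemma det_cross:
  fixes p r :: "nat \<Rightarrow> 'a::idom"
  shows "det (cross N p r) = (\<Prod>i<N. p i * p (2 * N - 1 - i) - r i * r (2 * N - 1 - i))"
proof -
  \<comment> \<open>\<open>\<pi>\<close> sends \<open>N + k\<close> to \<open>2 * N - 1 - k\<close>,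
    so the partner of an index \<open>i < N\<close> moves to \<open>N + i\<close>.\<close>
  define \<pi> where "\<pi> i = (if N \<le> i \<and> i < 2 * N then 3 * N - 1 - i else i)" for i
  have inv: "\<pi> (\<pi> i) = i" for i by (auto simp: \<pi>_def)
  have "bij_betw \<pi> {0..<2 * N} {0..<2 * N}"
    by (rule bij_betw_byWitness[where f' = \<pi>]) (simp_all add: inv, auto simp: \<pi>_def)
  then have perm: "\<pi> permutes {0..<2 * N}"
    by (rule bij_imp_permutes) (auto simp: \<pi>_def)
  have lt: "\<pi> i < 2 * N \<longleftrightarrow> i < 2 * N" for i by (auto simp: \<pi>_def)
  define B where "B = mat (2 * N) (2 * N) (\<lambda>(i, j). cross N p r $$ (\<pi> i, j))"
  \<comment> \<open>Transposing lets the rule for row permutations act on the columns too.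
    \<open>C\<close> is the transpose of the doubly permuted matrix, and the two signs
    cancel.\<close>
  define C where "C = mat (2 * N) (2 * N) (\<lambda>(i, j). B\<^sup>T $$ (\<pi> i, j))"
  have B: "B \<in> carrier_mat (2 * N) (2 * N)" and C: "C \<in> carrier_mat (2 * N) (2 * N)"
    by (simp_all add: B_def C_def)
  have "det C = signof \<pi> * det B"
    unfolding C_def using det_permute_rows[OF _ perm, of "B\<^sup>T"] B det_transpose[OF B] by simp
  also have "det B = signof \<pi> * det (cross N p r)"
    unfolding B_def by (rule det_permute_rows[OF _ perm]) simp
  finally have C1: "det C = det (cross N p r)"
    by (simp add: sign_def split: if_splits)
  have C2: "C = four_block_mat
      (mat N N (\<lambda>(i, j). if i = j then p i else 0))
      (mat N N (\<lambda>(i, j). if i = j then r (2 * N - 1 - i) else 0))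
      (mat N N (\<lambda>(i, j). if i = j then r i else 0))
      (mat N N (\<lambda>(i, j). if i = j then p (2 * N - 1 - i) else 0))" (is "_ = four_block_mat ?P ?Q ?R ?S")
  proof (rule eq_matI)
    fix i j assume "i < dim_row (four_block_mat ?P ?Q ?R ?S)" "j < dim_col (four_block_mat ?P ?Q ?R ?S)"
    then have ij: "i < 2 * N" "j < 2 * N" by simp_all
    have c1: "C $$ (i, j) = (if \<pi> j = \<pi> i then p (\<pi> j) else if \<pi> j + \<pi> i = 2 * N - 1 then r (\<pi> j) else 0)"
      using ij by (simp add: C_def B_def lt cross_index)
    have c2: "\<pi> j = \<pi> i \<longleftrightarrow> i = j" by (metis inv)
    have c3: "\<pi> j + \<pi> i = 2 * N - 1 \<longleftrightarrow> i < N \<and> j = i + N \<or> N \<le> i \<and> i = j + N"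
      using ij by (auto simp: \<pi>_def)
    have c4: "four_block_mat ?P ?Q ?R ?S $$ (i, j) =
        (if i < N then if i = j then p i else if j = i + N then r (2 * N - 1 - i) else 0
         else if i = j then p (3 * N - 1 - i) else if i = j + N then r j else 0)"
      using ij by (auto simp: le_diff_conv2 intro: arg_cong[of _ _ p])
    have e: "3 * N - 1 - (i + N) = 2 * N - 1 - i" by simp
    show "C $$ (i, j) = four_block_mat ?P ?Q ?R ?S $$ (i, j)"
    proof (cases "i = j")
      case True
      then show ?thesis unfolding c1 c4 c2 c3 using ij by (simp add: \<pi>_def)
    next
      case False
      then show ?thesis
        unfolding c1 c4 c2 c3 using ij e by (cases "i < N"; cases "j < N") (auto simp: \<pi>_def)
    qed
  qed (simp_all add: C_def)
  have diag_mult: "mat N N (\<lambda>(i, j). if i = j then f i else 0) * mat N N (\<lambda>(i, j). if i = j then g i else 0)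
      = mat N N (\<lambda>(i, j). if i = j then f i * g i else 0)" for f g :: "nat \<Rightarrow> 'a"
  proof (rule eq_matI)
    fix i j assume "i < dim_row (mat N N (\<lambda>(i, j). if i = j then f i * g i else 0))"
      "j < dim_col (mat N N (\<lambda>(i, j). if i = j then f i * g i else 0))"
    then have ij: "i < N" "j < N" by simp_all
    then have "(mat N N (\<lambda>(i, j). if i = j then f i else 0) * mat N N (\<lambda>(i, j). if i = j then g i else 0)) $$ (i, j)
        = (\<Sum>k = 0..<N. (if i = k then f i else 0) * (if k = j then g k else 0))"
      by (simp add: scalar_prod_def)
    also have "\<dots> = (\<Sum>k = 0..<N. if k = i then (if i = j then f i * g i else 0) else 0)"
      by (rule sum.cong) auto
    finally show "(mat N N (\<lambda>(i, j). if i = j then f i else 0) * mat N N (\<lambda>(i, j). if i = j then g i else 0)) $$ (i, j)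
        = mat N N (\<lambda>(i, j). if i = j then f i * g i else 0) $$ (i, j)"
      using ij by simp
  qed simp_all
  have C3: "det (four_block_mat ?P ?Q ?R ?S) = det (?P * ?S - ?Q * ?R)"
    by (rule det_four_block_mat[of _ N])
      (simp_all only: diag_mult mult.commute, simp_all)
  have C4: "?P * ?S - ?Q * ?R =
      mat N N (\<lambda>(i, j). if i = j then p i * p (2 * N - 1 - i) - r i * r (2 * N - 1 - i) else 0)"
    unfolding diag_mult by (rule eq_matI) (simp_all add: mult.commute)
  show ?thesis by (simp only: C1[symmetric] C2 C3 C4 det_diagonal)
qed

text \<open>Multiplying on the right by the block matrix with rows \<open>(0, 1)\<close> and \<open>(1, - B' A)\<close> makes the
  matrix block triangular; \<open>B\<close> need not commute with any other block.\<close>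

lemma det_four_block_mat_schur:
  fixes A B B' C D :: "'a::idom mat"
  assumes "A \<in> carrier_mat n n" "B \<in> carrier_mat n n" "B' \<in> carrier_mat n n"
    "C \<in> carrier_mat n n" "D \<in> carrier_mat n n"
    and BB': "B * B' = 1\<^sub>m n"
  shows "det (four_block_mat A B C D) * det (- 1\<^sub>m n) = det B * det (C - D * (B' * A))"
proof -
  let ?X = "- (B' * A)"
  let ?K = "four_block_mat (0\<^sub>m n n) (1\<^sub>m n) (1\<^sub>m n) ?X"
  have X: "?X \<in> carrier_mat n n" using assms by simp
  have "det ?K = det (0\<^sub>m n n * ?X - 1\<^sub>m n * 1\<^sub>m n)"
    by (rule det_four_block_mat) (use X in \<open>simp_all add: left_mult_one_mat[OF X] right_mult_one_mat[OF X]\<close>)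
  also have "0\<^sub>m n n * ?X - 1\<^sub>m n * 1\<^sub>m n = - 1\<^sub>m n"
    unfolding left_mult_zero_mat[OF X] by (intro eq_matI) auto
  finally have K: "det ?K = det (- 1\<^sub>m n)" .
  have BX: "B * ?X = - A"
  proof -
    have "B * ?X = - (B * (B' * A))" using assms by simp
    also have "B * (B' * A) = (B * B') * A"
      by (rule assoc_mult_mat[symmetric]) (use assms in auto)
    also have "\<dots> = A" unfolding BB' by (rule left_mult_one_mat) (use assms in auto)
    finally show ?thesis .
  qed
  have DX: "D * ?X = - (D * (B' * A))" using assms by simp
  have "four_block_mat A B C D * ?K = four_block_mat
      (A * 0\<^sub>m n n + B * 1\<^sub>m n) (A * 1\<^sub>m n + B * ?X) (C * 0\<^sub>m n n + D * 1\<^sub>m n) (C * 1\<^sub>m n + D * ?X)"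
    by (rule mult_four_block_mat[of _ n n _ n _ n _ _ n _ n]) (use assms X in simp_all)
  also have "\<dots> = four_block_mat B (0\<^sub>m n n) D (C - D * (B' * A))"
  proof -
    have "A * 0\<^sub>m n n + B * 1\<^sub>m n = B" "A * 1\<^sub>m n + B * ?X = 0\<^sub>m n n"
      "C * 0\<^sub>m n n + D * 1\<^sub>m n = D" "C * 1\<^sub>m n + D * ?X = C - D * (B' * A)"
      unfolding BX DX using assms by (auto intro!: eq_matI)
    then show ?thesis by simp
  qed
  finally have "det (four_block_mat A B C D * ?K) = det B * det (C - D * (B' * A))"
    using det_four_block_mat_upper_right_zero[OF assms(2) HOL.refl assms(5)
        minus_carrier_mat[OF mult_carrier_mat[OF assms(5) mult_carrier_mat[OF assms(3,1)]]]]
    by simp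
  moreover have "det (four_block_mat A B C D * ?K) = det (four_block_mat A B C D) * det ?K"
    by (rule det_mult[of _ "n + n"]) (use assms X in auto)
  ultimately show ?thesis using K by simp
qed

section \<open>The action on binary forms\<close>

lemma const2_mult [simp]: "const2 a * const2 b = const2 (a * b)"
  by (simp add: const2_def)

lemma const2_0 [simp]: "const2 0 = 0"
  by (simp add: const2_def)

lemma const2_power: "const2 a ^ k = const2 (a ^ k)"
  by (induction k) (simp_all add: const2_def one_pCons)

lemma const2_xy: "const2 c * (var_x ^ j * var_y ^ k) = monom (monom c j) k"
proof -
  have "var_x ^ j = [:monom 1 j:]"
    by (induction j) (simp_all add: var_x_def one_pCons monom_0 monom_Suc)
  moreover have "var_y ^ k = monom 1 k"
    by (induction k) (simp_all add: var_y_def monom_0 monom_Suc)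
  ultimately show ?thesis
    by (simp add: const2_def smult_monom)
qed

lemma xy_monom: "var_x ^ j * var_y ^ k = monom (monom 1 j) k"
  using const2_xy[of 1 j k] by (simp add: const2_def one_pCons[symmetric])

lemma coeff_xy_const2_xy:
  "coeff_xy (const2 c * (var_x ^ j * var_y ^ k)) i l = (if i = j \<and> l = k then c else 0)"
  by (simp add: const2_xy coeff_xy_def)

lemma subst_xy_monom: "subst_xy (var_x ^ j * var_y ^ k) u v = u ^ j * v ^ k"
proof -
  have "const2 (coeff_xy (var_x ^ j * var_y ^ k) a b) = (if a = j \<and> b = k then 1 else 0)" for a b
    by (auto simp: xy_monom coeff_xy_def const2_def one_pCons)
  moreover have "degree (var_x ^ j * var_y ^ k) = k"
    by (simp add: xy_monom degree_monom_eq)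
  moreover have "(\<Sum>a\<le>degree (coeff (var_x ^ j * var_y ^ k) b).
      (if a = j \<and> b = k then 1 else 0) * u ^ a * v ^ b) = (if b = k then u ^ j * v ^ k else 0)" for b
  proof (cases "b = k")
    case True
    have "degree (coeff (var_x ^ j * var_y ^ k) b) = j"
      using True by (simp add: xy_monom degree_monom_eq)
    moreover have "(\<Sum>a\<le>j. (if a = j then 1 else 0) * u ^ a * v ^ b)
        = (\<Sum>a\<le>j. if a = j then u ^ j * v ^ b else 0)"
      by (rule sum.cong) auto
    ultimately show ?thesis using True by simp
  qed simp
  ultimately show ?thesis by (simp add: subst_xy_def)
qed

section \<open>Diagonal and antidiagonal matrices in SL2 and their images under
  \<open>sigma\<close>\<close>

definition diag2 :: "complex \<Rightarrow> complex mat" where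
  "diag2 a = mat_of_rows_list 2 [[a, 0], [0, inverse a]]"

text \<open>For nonzero parameters, these matrices and the \<open>diag2\<close> ones form the
  normalizer of the diagonal torus in SL2, which contains the image of \<rho>.\<close>

definition anti2 :: "complex \<Rightarrow> complex mat" where
  "anti2 b = mat_of_rows_list 2 [[0, b], [- inverse b, 0]]"

lemma mat2_eqI:
  assumes "A \<in> carrier_mat 2 2" "B \<in> carrier_mat 2 2"
    "A $$ (0, 0) = B $$ (0, 0)" "A $$ (0, 1) = B $$ (0, 1)"
    "A $$ (1, 0) = B $$ (1, 0)" "A $$ (1, 1) = B $$ (1, 1)"
  shows "A = B"
proof (rule eq_matI)
  fix i j assume "i < dim_row B" "j < dim_col B"
  then have "i = 0 \<or> i = 1" "j = 0 \<or> j = 1" using assms(2) by auto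
  then show "A $$ (i, j) = B $$ (i, j)" using assms(3-6) by metis
qed (simp_all only: carrier_matD[OF assms(1)] carrier_matD[OF assms(2)])

lemma diag2_carrier [simp]: "diag2 a \<in> carrier_mat 2 2"
  and anti2_carrier [simp]: "anti2 a \<in> carrier_mat 2 2"
  by (intro carrier_matI; simp add: diag2_def anti2_def mat_of_rows_list_def)+

lemma diag2_index [simp]:
  "diag2 a $$ (0, 0) = a" "diag2 a $$ (0, Suc 0) = 0"
  "diag2 a $$ (Suc 0, 0) = 0" "diag2 a $$ (Suc 0, Suc 0) = inverse a"
  by (simp_all add: diag2_def mat_of_rows_list_def)

lemma anti2_index [simp]:
  "anti2 a $$ (0, 0) = 0" "anti2 a $$ (0, Suc 0) = a"
  "anti2 a $$ (Suc 0, 0) = - inverse a" "anti2 a $$ (Suc 0, Suc 0) = 0"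
  by (simp_all add: anti2_def mat_of_rows_list_def)

lemma mat2_mult_index:
  assumes "A \<in> carrier_mat 2 2" "B \<in> carrier_mat 2 2" "i < 2" "j < 2"
  shows "(A * B) $$ (i, j) = A $$ (i, 0) * B $$ (0, j) + A $$ (i, Suc 0) * B $$ (Suc 0, j)"
proof -
  have "(A * B) $$ (i, j) = (\<Sum>k\<in>{0..<2}. A $$ (i, k) * B $$ (k, j))"
    using assms by (auto simp: scalar_prod_def)
  also have "{0..<2} = {0, Suc 0}" by auto
  finally show ?thesis by simp
qed

text \<open>With \<open>inverse 0 = 0\<close> the entries agree at zero parameters as well.\<close>

lemma diag2_anti2_mult:
  "diag2 a * diag2 b = diag2 (a * b)" "diag2 a * anti2 b = anti2 (a * b)"
  "anti2 a * diag2 b = anti2 (a * inverse b)" "anti2 a * anti2 b = diag2 (- (a * inverse b))"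
  by (rule mat2_eqI, rule mult_carrier_mat[of _ 2 2 _ 2], simp_all add: mat2_mult_index)+

lemma diag2_1: "diag2 1 = 1\<^sub>m 2"
  by (rule mat2_eqI) simp_all

lemma det_diag2: "a \<noteq> 0 \<Longrightarrow> det (diag2 a) = 1"
  and det_anti2: "a \<noteq> 0 \<Longrightarrow> det (anti2 a) = 1"
proof -
  have "diag2 a = cross 1 (\<lambda>i. if i = 0 then a else inverse a) (\<lambda>_. 0)"
    by (rule mat2_eqI) (simp_all add: cross_def)
  then show "a \<noteq> 0 \<Longrightarrow> det (diag2 a) = 1" by (simp add: det_cross)
  have "anti2 a = cross 1 (\<lambda>_. 0) (\<lambda>i. if i = 0 then a else - inverse a)"
    by (rule mat2_eqI) (simp_all add: cross_def)
  then show "a \<noteq> 0 \<Longrightarrow> det (anti2 a) = 1" by (simp add: det_cross)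
qed

text \<open>The inverse is a definite description, so a two-sided inverse must also be shown unique;
  associativity gives this.\<close>

lemma SL_2_inv:
  assumes "A \<in> carrier (SL 2)" "B \<in> carrier (SL 2)" "A * B = 1\<^sub>m 2" "B * A = 1\<^sub>m 2"
  shows "inv\<^bsub>SL 2\<^esub> A = B"
proof -
  have "C = B" if C: "C \<in> carrier (SL 2)" and CA: "C * A = 1\<^sub>m 2" for C
  proof -
    have carr: "A \<in> carrier_mat 2 2" "B \<in> carrier_mat 2 2" "C \<in> carrier_mat 2 2"
      using C assms by (simp_all add: SL_def)
    have "C = C * (A * B)" unfolding assms(3) by (rule right_mult_one_mat[OF carr(3), symmetric])
    also have "\<dots> = (C * A) * B" by (rule assoc_mult_mat[OF carr(3,1,2), symmetric])
    also have "\<dots> = B" unfolding CA by (rule left_mult_one_mat[OF carr(2)])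
    finally show ?thesis .
  qed
  moreover have "B \<in> carrier (SL 2) \<and> A \<otimes>\<^bsub>SL 2\<^esub> B = \<one>\<^bsub>SL 2\<^esub> \<and> B \<otimes>\<^bsub>SL 2\<^esub> A = \<one>\<^bsub>SL 2\<^esub>"
    using assms by (simp add: SL_def)
  ultimately show ?thesis
    unfolding m_inv_def by (intro the_equality) (simp_all add: SL_def)
qed

lemma diag2_in_SL [simp]: "a \<noteq> 0 \<Longrightarrow> diag2 a \<in> carrier (SL 2)"
  and anti2_in_SL [simp]: "a \<noteq> 0 \<Longrightarrow> anti2 a \<in> carrier (SL 2)"
  by (simp_all add: SL_def det_diag2 det_anti2)

lemma inv_diag2: "a \<noteq> 0 \<Longrightarrow> inv\<^bsub>SL 2\<^esub> (diag2 a) = diag2 (inverse a)"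
  and inv_anti2: "a \<noteq> 0 \<Longrightarrow> inv\<^bsub>SL 2\<^esub> (anti2 a) = anti2 (- a)"
  by (rule SL_2_inv; simp add: diag2_anti2_mult diag2_1)+

text \<open>The inverse matrix scales \<open>x\<close> by \<open>inverse a\<close> and
  \<open>y\<close> by \<open>a\<close>, so each monomial is an eigenvector whose weight is the
  exponent of \<open>y\<close> minus that of \<open>x\<close>.\<close>

lemma sigma_diag2:
  assumes "a \<noteq> 0"
  shows "sigma (2 * N) (diag2 a) = cross N (\<lambda>i. a powi (2 * int N - 1 - 2 * int i)) (\<lambda>_. 0)"
proof (rule eq_matI; simp only: cross_dim)
  fix i j assume ij: "i < 2 * N" "j < 2 * N"
  have "SL2_act (diag2 a) (var_x ^ j * var_y ^ (2 * N - 1 - j))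
      = const2 (inverse a ^ j * a ^ (2 * N - 1 - j)) * (var_x ^ j * var_y ^ (2 * N - 1 - j))"
  proof -
    have "SL2_act (diag2 a) (var_x ^ j * var_y ^ (2 * N - 1 - j))
        = (const2 (inverse a) * var_x) ^ j * (const2 a * var_y) ^ (2 * N - 1 - j)"
      using assms by (simp add: SL2_act_def Let_def inv_diag2 subst_xy_monom)
    also have "\<dots> = (const2 (inverse a ^ j) * const2 (a ^ (2 * N - 1 - j))) * (var_x ^ j * var_y ^ (2 * N - 1 - j))"
      by (simp only: power_mult_distrib const2_power mult_ac)
    finally show ?thesis by (simp only: const2_mult)
  qed
  moreover have "inverse a ^ j * a ^ (2 * N - 1 - j) = a powi (2 * int N - 1 - 2 * int j)"
  proof -
    have "a powi (2 * int N - 1 - 2 * int j) = a powi (int (2 * N - 1 - j) - int j)"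
      using ij by (intro arg_cong[of _ _ "power_int a"]) simp
    also have "\<dots> = a ^ (2 * N - 1 - j) / a ^ j"
      using assms by (simp add: power_int_diff)
    finally show ?thesis by (simp add: field_simps power_inverse)
  qed
  ultimately show "sigma (2 * N) (diag2 a) $$ (i, j)
      = cross N (\<lambda>i. a powi (2 * int N - 1 - 2 * int i)) (\<lambda>_. 0) $$ (i, j)"
    using ij by (auto simp: sigma_def cross_index coeff_xy_const2_xy)
qed (simp_all add: sigma_def)

text \<open>The inverse matrix sends \<open>x\<close> to \<open>- b * y\<close> and \<open>y\<close>
  to \<open>inverse b * x\<close>, so column \<open>j\<close> has its only entry in row
  \<open>i = 2 * N - 1 - j\<close>. As \<open>i + j\<close> is odd, the sign \<open>(-1) ^ j\<close>
  equals \<open>- ((-1) ^ i)\<close>.\<close>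

lemma sigma_anti2:
  assumes "b \<noteq> 0"
  shows "sigma (2 * N) (anti2 b) =
    cross N (\<lambda>_. 0) (\<lambda>i. - ((-1) ^ i * b powi (2 * int N - 1 - 2 * int i)))"
proof (rule eq_matI; simp only: cross_dim)
  fix i j assume ij: "i < 2 * N" "j < 2 * N"
  have par: "2 * N - Suc j \<noteq> j" using ij by presburger
  have "SL2_act (anti2 b) (var_x ^ j * var_y ^ (2 * N - 1 - j))
      = const2 ((- b) ^ j * inverse b ^ (2 * N - 1 - j)) * (var_x ^ (2 * N - 1 - j) * var_y ^ j)"
  proof -
    have "SL2_act (anti2 b) (var_x ^ j * var_y ^ (2 * N - 1 - j))
        = (const2 (- b) * var_y) ^ j * (const2 (inverse b) * var_x) ^ (2 * N - 1 - j)"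
      using assms by (simp add: SL2_act_def Let_def inv_anti2 subst_xy_monom)
    also have "\<dots> = (const2 ((- b) ^ j) * const2 (inverse b ^ (2 * N - 1 - j))) * (var_x ^ (2 * N - 1 - j) * var_y ^ j)"
      by (simp only: power_mult_distrib const2_power mult_ac)
    finally show ?thesis by (simp only: const2_mult)
  qed
  moreover have "(- b) ^ j * inverse b ^ (2 * N - 1 - j)
      = - ((-1) ^ i * b powi (2 * int N - 1 - 2 * int i))" if "i = 2 * N - 1 - j"
  proof -
    have "b powi (2 * int N - 1 - 2 * int i) = b powi (int j - int i)"
      using ij that by (intro arg_cong[of _ _ "power_int b"]) simp
    also have "\<dots> = b ^ j * inverse b ^ i"
      using assms by (simp add: power_int_diff field_simps power_inverse)
    moreover have "(-1::complex) ^ j * (-1) ^ i = -1"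
    proof -
      have "odd (j + i)" using ij that by simp
      then show ?thesis by (simp flip: power_add)
    qed
    then have "(-1::complex) ^ j = - ((-1) ^ i)"
      by (cases "even i"; cases "even j") auto
    ultimately show ?thesis
      using that by (simp add: power_minus[of b])
  qed
  ultimately show "sigma (2 * N) (anti2 b) $$ (i, j) =
    cross N (\<lambda>_. 0) (\<lambda>i. - ((-1) ^ i * b powi (2 * int N - 1 - 2 * int i))) $$ (i, j)"
    using ij par by (auto simp: sigma_def cross_index coeff_xy_const2_xy)
qed (simp_all add: sigma_def)

section \<open>The Fox matrix of the double twist knot\<close>

lemma rf_const_0 [simp]: "rf_const 0 = 0"
  and rf_const_1 [simp]: "rf_const 1 = 1"
  and rf_const_add: "rf_const (a + b) = rf_const a + rf_const b"
  and rf_const_mult: "rf_const (a * b) = rf_const a * rf_const b"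
  and rf_const_uminus: "rf_const (- a) = - rf_const a"
  by (simp_all add: rf_const_def one_pCons[symmetric] flip: to_fract_add to_fract_mult to_fract_uminus)

lemma rf_const_sum: "rf_const (sum f A) = (\<Sum>x\<in>A. rf_const (f x))"
  by (induction A rule: infinite_finite_induct) (simp_all add: rf_const_add)

text \<open>A homomorphism gives only products of values; this solves such a product for the value
  at the identity or at an inverse letter.\<close>

lemma left_inverse_mat_mult:
  fixes A :: "complex mat"
  assumes "A \<in> carrier_mat k k" "A' \<in> carrier_mat k k" "B \<in> carrier_mat k k"
    and "A' * A = 1\<^sub>m k" "A * B = C"
  shows "B = A' * C"
proof -
  have "A' * C = (A' * A) * B"
    unfolding assms(5)[symmetric] by (rule assoc_mult_mat[OF assms(2,1,3), symmetric])
  also have "\<dots> = B" unfolding assms(4) by (rule left_mult_one_mat[OF assms(3)])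
  finally show ?thesis by simp
qed

lemma diag2_inverse_mult: "a \<noteq> 0 \<Longrightarrow> diag2 (inverse a) * diag2 a = 1\<^sub>m 2"
  by (simp add: diag2_anti2_mult diag2_1)

lemma anti2_inverse_mult: "a \<noteq> 0 \<Longrightarrow> anti2 (- a) * anti2 a = 1\<^sub>m 2"
  by (simp add: diag2_anti2_mult diag2_1)

section \<open>Block determinants and the contribution of one two-dimensional piece\<close>

definition geo :: "nat \<Rightarrow> 'a::field \<Rightarrow> 'a" where
  "geo m x = (\<Sum>b<m. x ^ b)"

text \<open>Where \<open>x1\<close> and \<open>x2\<close> act by \<open>x\<close> and
  \<open>x ^ (2 * m)\<close>, \<open>geo\<close> is the Fox derivative of \<open>x1 ^ m\<close> by
  \<open>x1\<close>, and \<open>geo_inv\<close> is minus that of the \<open>n\<close>-th power of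
  the inverse of \<open>x2\<close> by \<open>x2\<close>.\<close>

definition geo_inv :: "nat \<Rightarrow> nat \<Rightarrow> 'a::field \<Rightarrow> 'a" where
  "geo_inv m n x = (\<Sum>b<n. inverse x ^ (2 * m * Suc b))"

text \<open>The determinant contributed by one two-dimensional piece.  Primes denote the effect of
  \<open>\<eta> \<mapsto> \<eta>\<^sup>-\<^sup>1\<close>; for the knot, \<open>a = 1 + \<eta> + \<dots> + \<eta>\<^sup>m\<^sup>-\<^sup>1\<close>, \<open>f = \<eta>\<^sup>-\<^sup>2\<^sup>m\<^sup>n\<close> and
  \<open>g = \<eta>\<^sup>m (\<eta>\<^sup>-\<^sup>2\<^sup>m + \<eta>\<^sup>-\<^sup>4\<^sup>m + \<dots> + \<eta>\<^sup>-\<^sup>2\<^sup>m\<^sup>n)\<close>.\<close>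

definition piece_det :: "'a::comm_ring_1 \<Rightarrow> 'a \<Rightarrow> 'a \<Rightarrow> 'a \<Rightarrow> 'a \<Rightarrow> 'a \<Rightarrow> 'a \<Rightarrow> 'a" where
  "piece_det z g g' a a' f f' =
     (g - z\<^sup>2 * g') * (g' - z\<^sup>2 * g) * (a * a') + z\<^sup>2 * (((g + g') * a' - f') * ((g + g') * a - f))"

text \<open>The even size removes the sign factor in
  \<open>det_four_block_mat_schur\<close>.\<close>

lemma det_uminus_one: "det (- 1\<^sub>m (2 * N)) = (1 :: 'a::idom)"
proof -
  have "- 1\<^sub>m (2 * N) = (cross N (\<lambda>_. - 1) (\<lambda>_. 0) :: 'a mat)"
    by (rule eq_matI) (auto simp: cross_index)
  then show ?thesis by (simp add: det_cross)
qed

text \<open>The upper right block is diagonal, and by the hypothesis its inverse is \<open>c\<close>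
  read backwards. Elimination with it leaves one matrix of \<open>cross\<close> shape, whose
  determinant is a product over the index pairs.\<close>

lemma det_cross_blocks:
  fixes a c e f :: "nat \<Rightarrow> 'a::field" and z :: 'a
  assumes c: "\<And>i. i < 2 * N \<Longrightarrow> c i * c (2 * N - 1 - i) = 1"
  shows "det (four_block_mat
      (cross N (\<lambda>i. - a i) (\<lambda>i. - ((-1) ^ i * z * a (2 * N - 1 - i))))
      (cross N c (\<lambda>_. 0))
      (cross N (\<lambda>_. 0) (\<lambda>i. - ((-1) ^ i * z * f (2 * N - 1 - i))))
      (cross N e (\<lambda>i. (-1) ^ i * z * e (2 * N - 1 - i)))) =
    (\<Prod>i<N. piece_det z (e i * c (2 * N - 1 - i)) (e (2 * N - 1 - i) * c i) (a i) (a (2 * N - 1 - i))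
      (f i) (f (2 * N - 1 - i)))"
    (is "det (four_block_mat ?A ?B ?C ?D) = _")
proof -
  let ?r = "\<lambda>i. 2 * N - 1 - i"
  let ?B' = "cross N (\<lambda>i. c (?r i)) (\<lambda>_. 0)"
  let ?g = "\<lambda>i. e i * c (?r i)"
  have rr: "?r (?r i) = i" if "i < 2 * N" for i using that by simp
  have rl: "?r i < 2 * N" if "i < 2 * N" for i using that by simp
  have s: "(-1) ^ ?r i = - ((-1) ^ i :: 'a)" if "i < 2 * N" for i
  proof -
    have "odd (?r i) \<longleftrightarrow> even i" using that by simp
    then show ?thesis by (cases "even i") auto
  qed
  have ss: "(-1) ^ i * (-1) ^ i = (1 :: 'a)" for i by (simp flip: power_add)
  have "?B * ?B' = 1\<^sub>m (2 * N)"
    unfolding cross_mult cross_one by (rule cross_cong) (use c in simp_all)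
  then have "det (four_block_mat ?A ?B ?C ?D) * det (- 1\<^sub>m (2 * N)) = det ?B * det (?C - ?D * (?B' * ?A))"
    by (intro det_four_block_mat_schur cross_carrier)
  moreover have "det ?B = 1"
    using c by (simp add: det_cross)
  moreover have "?C - ?D * (?B' * ?A) = cross N
      (\<lambda>i. (?g i - z\<^sup>2 * ?g (?r i)) * a i)
      (\<lambda>i. (-1) ^ i * z * ((?g i + ?g (?r i)) * a (?r i) - f (?r i)))"
    unfolding cross_mult cross_minus
  proof (rule cross_cong)
    fix i assume i: "i < 2 * N"
    show "0 - (e i * (c (?r i) * - a i + 0 * - ((-1) ^ ?r i * z * a (?r (?r i)))) +
        (-1) ^ i * z * e (?r i) *
        (c (?r (?r i)) * - ((-1) ^ ?r i * z * a (?r (?r i))) + 0 * - a (?r (?r i)))) =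
      (?g i - z\<^sup>2 * ?g (?r i)) * a i"
      unfolding rr[OF i] s[OF i] using ss[of i] by (simp add: power2_eq_square algebra_simps)
    show "- ((-1) ^ i * z * f (?r i)) -
      (e i * (c (?r i) * - ((-1) ^ i * z * a (?r i)) + 0 * - a (?r i)) +
       (-1) ^ i * z * e (?r i) * (c (?r (?r i)) * - a (?r i) + 0 * - ((-1) ^ ?r (?r i) * z * a (?r (?r (?r i)))))) =
      (-1) ^ i * z * ((?g i + ?g (?r i)) * a (?r i) - f (?r i))"
      unfolding rr[OF i] by (simp add: algebra_simps)
  qed
  ultimately have "det (four_block_mat ?A ?B ?C ?D) =
      (\<Prod>i<N. (?g i - z\<^sup>2 * ?g (?r i)) * a i * ((?g (?r i) - z\<^sup>2 * ?g (?r (?r i))) * a (?r i)) -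
        (-1) ^ i * z * ((?g i + ?g (?r i)) * a (?r i) - f (?r i)) *
        ((-1) ^ ?r i * z * ((?g (?r i) + ?g (?r (?r i))) * a (?r (?r i)) - f (?r (?r i)))))"
    by (simp only: det_uminus_one det_cross mult_1_left mult_1_right)
  also have "\<dots> = (\<Prod>i<N. piece_det z (e i * c (?r i)) (e (?r i) * c i) (a i) (a (?r i)) (f i) (f (?r i)))"
  proof (rule prod.cong[OF HOL.refl])
    fix i assume "i \<in> {..<N}"
    then have i: "i < 2 * N" by simp
    show "(?g i - z\<^sup>2 * ?g (?r i)) * a i * ((?g (?r i) - z\<^sup>2 * ?g (?r (?r i))) * a (?r i)) -
        (-1) ^ i * z * ((?g i + ?g (?r i)) * a (?r i) - f (?r i)) *
        ((-1) ^ ?r i * z * ((?g (?r i) + ?g (?r (?r i))) * a (?r (?r i)) - f (?r (?r i))))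
      = piece_det z (e i * c (?r i)) (e (?r i) * c i) (a i) (a (?r i)) (f i) (f (?r i))"
    proof -
      \<comment> \<open>The indices \<open>i\<close> and \<open>2 * N - 1 - i\<close> have opposite
        parity, so the product of the two antidiagonal entries is negative and the determinant
        acquires a plus sign.\<close>
      have key: "x * z * u * (- x * z * v) = - (z\<^sup>2 * (u * v))" if "x * x = 1" for x u v :: 'a
      proof -
        have "x * z * u * (- x * z * v) = - ((x * x) * (z * z) * (u * v))" by simp
        then show ?thesis unfolding that power2_eq_square by simp
      qed
      have reorder: "p * \<alpha> * (p' * \<alpha>') - - (z\<^sup>2 * ((x + y) * \<alpha>' - u) * ((y + x) * \<alpha> - u'))
          = p * p' * (\<alpha> * \<alpha>') + z\<^sup>2 * (((x + y) * \<alpha>' - u) * ((x + y) * \<alpha> - u'))"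
        for p p' \<alpha> \<alpha>' x y u u' :: 'a
        unfolding add.commute[of y x] by (simp only: mult_ac diff_minus_eq_add)
      show ?thesis
        unfolding rr[OF i] s[OF i] piece_det_def key[OF ss] reorder[symmetric] by (simp only: mult.assoc)
    qed
  qed
  finally show ?thesis .
qed

section \<open>The representation on words, and the blocks of the Fox matrix\<close>

locale lin_rep =
  fixes m n :: nat and \<rho> :: "gen word set \<Rightarrow> complex mat" and w :: complex
  assumes mn: "0 < m" "0 < n"
    and w0: "w \<noteq> 0" and w_root: "w ^ (4 * m * n - 1) = 1"
    and hom: "\<rho> \<in> hom (knot_group m n) (SL 2)"
    and rho_X1: "\<rho> (knot_gen m n X1) = diag2 w"
    and rho_X2: "\<rho> (knot_gen m n X2) = diag2 (w ^ (2 * m))"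
    and rho_Mu: "\<rho> (knot_gen m n Mu) = anti2 1"
begin

definition R :: "gen word \<Rightarrow> complex mat" where
  "R v = \<rho> (word_class (lin_relators m n) v)"

lemma R_append: "R (u @ v) = R u * R v"
  using hom_mult[OF hom word_class_in_carrier[of "lin_relators m n" u, folded knot_group_def]
      word_class_in_carrier[of "lin_relators m n" v, folded knot_group_def]]
  by (simp add: R_def SL_def knot_group_def)

lemma R_carrier: "R v \<in> carrier_mat 2 2"
  using hom_in_carrier[OF hom word_class_in_carrier[of "lin_relators m n" v, folded knot_group_def]]
  by (simp add: R_def SL_def)

lemma R_gens: "R [(X1, True)] = diag2 w" "R [(X2, True)] = diag2 (w ^ (2 * m))" "R [(Mu, True)] = anti2 1"
  using rho_X1 rho_X2 rho_Mu by (simp_all add: R_def knot_gen_def group_gen_def)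

text \<open>Appending the empty word to a letter changes nothing, and the matrix of the letter is
  invertible, so it can be cancelled.\<close>

lemma R_Nil: "R [] = 1\<^sub>m 2"
proof -
  have "diag2 w * R [] = diag2 w"
    using R_append[of "[(X1, True)]" "[]"] by (simp add: R_gens)
  then have "R [] = diag2 (inverse w) * diag2 w"
    by (intro left_inverse_mat_mult[of "diag2 w" 2] R_carrier diag2_inverse_mult w0) simp_all
  then show ?thesis by (simp add: diag2_inverse_mult w0)
qed

lemma R_inverse_letter: "R [(g, True)] * R [(g, False)] = 1\<^sub>m 2"
  using word_class_cancel[of "lin_relators m n" g True "[]"]
  by (simp add: R_append[symmetric] R_Nil[symmetric]) (simp add: R_def)

lemma R_inverse_gens:
  "R [(X1, False)] = diag2 (inverse w)" "R [(X2, False)] = diag2 (inverse (w ^ (2 * m)))"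
  "R [(Mu, False)] = anti2 (- 1)"
proof -
  have "R [(X1, False)] = diag2 (inverse w) * 1\<^sub>m 2"
    using R_inverse_letter[of X1] w0
    by (intro left_inverse_mat_mult[of "diag2 w" 2] R_carrier diag2_inverse_mult) (simp_all add: R_gens)
  then show "R [(X1, False)] = diag2 (inverse w)"
    by (simp add: right_mult_one_mat[OF diag2_carrier])
  have "R [(X2, False)] = diag2 (inverse (w ^ (2 * m))) * 1\<^sub>m 2"
    using R_inverse_letter[of X2] w0
    by (intro left_inverse_mat_mult[of "diag2 (w ^ (2 * m))" 2] R_carrier diag2_inverse_mult) (simp_all add: R_gens)
  then show "R [(X2, False)] = diag2 (inverse (w ^ (2 * m)))"
    by (simp add: right_mult_one_mat[OF diag2_carrier])
  have "R [(Mu, False)] = anti2 (- 1) * 1\<^sub>m 2"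
    using R_inverse_letter[of Mu]
    by (intro left_inverse_mat_mult[of "anti2 1" 2] R_carrier anti2_inverse_mult) (simp_all add: R_gens)
  then show "R [(Mu, False)] = anti2 (- 1)"
    by (simp add: right_mult_one_mat[OF anti2_carrier])
qed

lemma R_Cons: "R (l # v) = R [l] * R v"
  using R_append[of "[l]" v] by simp

lemma R_replicate:
  assumes "R [l] = diag2 a"
  shows "R (replicate k l) = diag2 (a ^ k)"
proof (induction k)
  case (Suc k)
  then show ?case using assms R_Cons[of l "replicate k l"] by (simp add: diag2_anti2_mult)
qed (simp add: R_Nil diag2_1)

lemmas R_replicates = R_replicate[OF R_gens(1)] R_replicate[OF R_gens(2)]
  R_replicate[OF R_inverse_gens(1)] R_replicate[OF R_inverse_gens(2)]

lemma R_letters: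
  "R ((X1, True) # v) = diag2 w * R v" "R ((X2, True) # v) = diag2 (w ^ (2 * m)) * R v"
  "R ((Mu, True) # v) = anti2 1 * R v" "R ((Mu, False) # v) = anti2 (- 1) * R v"
  using R_Cons[of "(X1, True)" v] R_Cons[of "(X2, True)" v] R_Cons[of "(Mu, True)" v]
    R_Cons[of "(Mu, False)" v]
  by (simp_all only: R_gens R_inverse_gens)

lemma mult_R_Nil: "anti2 a * R [] = anti2 a"
  unfolding R_Nil by (rule right_mult_one_mat[OF anti2_carrier])

lemmas R_word = R_letters R_append R_replicates mult_R_Nil diag2_anti2_mult

text \<open>The eigenvalue of \<open>x1\<close> on the \<open>i\<close>-th monomial. The weights are
  odd and decrease, being positive exactly for \<open>i < N\<close>.\<close>

definition \<eta> :: "nat \<Rightarrow> nat \<Rightarrow> complex" where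
  "\<eta> N i = w powi (2 * int N - 1 - 2 * int i)"

lemma eta_nonzero [simp]: "\<eta> N i \<noteq> 0"
  using w0 by (simp add: \<eta>_def)

lemma eta_reverse: "i < 2 * N \<Longrightarrow> \<eta> N (2 * N - 1 - i) = inverse (\<eta> N i)"
  unfolding \<eta>_def power_int_minus[symmetric] by (intro arg_cong[of _ _ "power_int w"]) simp

lemma power_powi: "(w ^ a) powi (2 * int N - 1 - 2 * int i) = \<eta> N i ^ a"
  by (simp only: \<eta>_def power_int_power power_int_power' mult.commute)

lemma inverse_powi: "inverse x powi k = inverse (x powi k)" for x :: complex
  by (rule power_int_inverse)

definition entry :: "nat \<Rightarrow> gen word \<Rightarrow> nat \<Rightarrow> nat \<Rightarrow> ratfun" where
  "entry N v i j = rf_t powi (mu_exponent v) * rf_const (sigma (2 * N) (R v) $$ (i, j))"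

lemma Phi_knot_fox_index:
  assumes "i < 2 * N" "j < 2 * N"
  shows "Phi (2 * N) (sigma (2 * N) \<circ> \<rho>) (knot_fox m n r x) $$ (i, j) = fox_sum x r (\<lambda>v. entry N v i j)"
  using assms by (simp add: Phi_index int_linear_knot_fox entry_def R_def)

text \<open>The words met in the Fox derivatives have exponent 0 or 1 in \<mu>. In the first case
  the matrix is diagonal, in the second (\<open>entry_anti2\<close>) it is antidiagonal and carries
  one factor \<open>rf_t\<close>.\<close>

lemma entry_diag2:
  assumes "R v = diag2 x" "x \<noteq> 0" "mu_exponent v = 0" "i < 2 * N" "j < 2 * N"
  shows "entry N v i j = (if i = j then rf_const (x powi (2 * int N - 1 - 2 * int i)) else 0)"
  using assms by (simp add: entry_def sigma_diag2 cross_index)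

lemma entry_anti2:
  assumes "R v = anti2 x" "x \<noteq> 0" "mu_exponent v = 1" "i < 2 * N" "j < 2 * N"
  shows "entry N v i j = (if i \<noteq> j \<and> i + j = 2 * N - 1
    then - ((-1) ^ i * rf_t * rf_const (x powi (2 * int N - 1 - 2 * int i))) else 0)"
proof -
  have "rf_const ((-1) ^ i) = (-1) ^ i"
    by (cases "even i") (simp_all add: rf_const_uminus)
  then show ?thesis
    using assms by (simp add: entry_def sigma_anti2 cross_index rf_const_uminus rf_const_mult)
qed

lemma lin_r1_eq: "lin_r1 m = (Mu, True) # replicate m (X1, True) @ (Mu, False) # (X2, True) # replicate m (X1, False)"
  using mn by (simp add: lin_r1_def gpow_def)

lemma lin_r2_eq: "lin_r2 n = (Mu, True) # replicate n (X2, False) @ (X1, True) # (Mu, False) # replicate n (X2, True)"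
  using mn by (simp add: lin_r2_def gpow_def)

text \<open>The positive block of \<open>x1\<close> letters, preceded by \<mu>, gives the
  antidiagonal. For the negative block the prefix up to \<open>x2\<close> acts as
  \<open>x1 ^ m\<close>, by the first relation, so removing \<open>Suc a\<close> letters leaves
  \<open>w ^ (m - Suc a)\<close>; reversing the sum gives \<open>geo\<close>.\<close>

lemma Phi_fox_11:
  "Phi (2 * N) (sigma (2 * N) \<circ> \<rho>) (knot_fox m n (lin_r1 m) X1) =
   cross N (\<lambda>i. - rf_const (geo m (\<eta> N i)))
     (\<lambda>i. - ((-1) ^ i * rf_t * rf_const (geo m (inverse (\<eta> N i)))))" (is "?L = ?R")
proof (rule eq_matI)
  fix i j assume "i < dim_row ?R" "j < dim_col ?R"
  then have ij: "i < 2 * N" "j < 2 * N" by simp_all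
  have v1: "R ((Mu, True) # replicate a (X1, True)) = anti2 (inverse (w ^ a))" for a
    unfolding R_word by simp
  have e1: "entry N ((Mu, True) # replicate a (X1, True)) i j =
      (if i \<noteq> j \<and> i + j = 2 * N - 1 then - ((-1) ^ i * rf_t * rf_const (inverse (\<eta> N i) ^ a)) else 0)" for a
    using w0 ij by (subst entry_anti2[OF v1]) (simp_all add: inverse_powi power_powi power_inverse)
  have v2: "R ((Mu, True) # replicate m (X1, True) @ (Mu, False) # (X2, True) # replicate (Suc a) (X1, False))
      = diag2 (w ^ (m - Suc a))" if "a < m" for a
  proof -
    have "R ((Mu, True) # replicate m (X1, True) @ (Mu, False) # (X2, True) # replicate (Suc a) (X1, False))
      = diag2 (w ^ (2 * m) * inverse w ^ Suc a * inverse (w ^ m))"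
      unfolding R_word using w0 by (intro arg_cong[of _ _ diag2]) (simp add: field_simps)
    also have "w ^ (2 * m) * inverse w ^ Suc a * inverse (w ^ m) = w ^ (m - Suc a)"
    proof -
      have "w ^ m = w ^ (m - Suc a) * w ^ Suc a" 
        unfolding power_add[symmetric] using that by (intro arg_cong[of _ _ "power w"]) simp
      moreover have "w ^ (2 * m) = w ^ m * w ^ m" by (simp only: mult_2 power_add)
      ultimately have eq: "w ^ (2 * m) = w ^ (m - Suc a) * (w ^ Suc a * w ^ m)" by (simp only: mult.assoc)
      have cancel: "x * (y * z) * inverse y * inverse z = x" if "y \<noteq> 0" "z \<noteq> 0" for x y z :: complex
        using that by (simp add: field_simps)
      show ?thesis
        unfolding eq power_inverse by (rule cancel) (use w0 in simp_all)
    qed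
    finally show ?thesis .
  qed
  have e2: "entry N ((Mu, True) # replicate m (X1, True) @ (Mu, False) # (X2, True) # replicate (Suc a) (X1, False)) i j =
      (if i = j then rf_const (\<eta> N i ^ (m - Suc a)) else 0)" if "a < m" for a
    using w0 ij by (subst entry_diag2[OF v2[OF that]]) (simp_all add: power_powi)
  have "?L $$ (i, j) = (\<Sum>a<m. entry N ((Mu, True) # replicate a (X1, True)) i j)
     - (\<Sum>a<m. entry N ((Mu, True) # replicate m (X1, True) @ (Mu, False) # (X2, True) # replicate (Suc a) (X1, False)) i j)"
    unfolding Phi_knot_fox_index[OF ij] lin_r1_eq
    by (simp add: fox_sum_append fox_sum_replicate_pos fox_sum_replicate_neg del: replicate_Suc)
  also have "\<dots> = (\<Sum>a<m. if i \<noteq> j \<and> i + j = 2 * N - 1 then - ((-1) ^ i * rf_t * rf_const (inverse (\<eta> N i) ^ a)) else 0)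
     - (\<Sum>a<m. if i = j then rf_const (\<eta> N i ^ (m - Suc a)) else 0)"
    by (intro arg_cong2[where f = minus] sum.cong HOL.refl) (simp_all add: e1 e2 del: replicate_Suc)
  also have "\<dots> = ?R $$ (i, j)"
    unfolding cross_index[OF ij] geo_def rf_const_sum
      sum.nat_diff_reindex[of "\<lambda>a. rf_const (\<eta> N i ^ a)" m, symmetric]
    by (simp add: sum_negf sum_distrib_left)
  finally show "?L $$ (i, j) = ?R $$ (i, j)" .
qed (simp_all add: Phi_def)

lemma Phi_fox_12:
  "Phi (2 * N) (sigma (2 * N) \<circ> \<rho>) (knot_fox m n (lin_r1 m) X2) =
   cross N (\<lambda>i. rf_const (inverse (\<eta> N i) ^ m)) (\<lambda>_. 0)" (is "?L = ?R")
proof (rule eq_matI)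
  fix i j assume "i < dim_row ?R" "j < dim_col ?R"
  then have ij: "i < 2 * N" "j < 2 * N" by simp_all
  have v: "R ((Mu, True) # replicate m (X1, True) @ [(Mu, False)]) = diag2 (inverse (w ^ m))"
    unfolding R_word by simp
  have "?L $$ (i, j) = entry N ((Mu, True) # replicate m (X1, True) @ [(Mu, False)]) i j"
    unfolding Phi_knot_fox_index[OF ij] lin_r1_eq
    by (simp add: fox_sum_append fox_sum_replicate_other)
  also have "\<dots> = ?R $$ (i, j)"
    using w0 ij by (subst entry_diag2[OF v]) (simp_all add: cross_index inverse_powi power_powi power_inverse)
  finally show "?L $$ (i, j) = ?R $$ (i, j)" .
qed (simp_all add: Phi_def)

lemma Phi_fox_21:
  "Phi (2 * N) (sigma (2 * N) \<circ> \<rho>) (knot_fox m n (lin_r2 n) X1) =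
   cross N (\<lambda>_. 0) (\<lambda>i. - ((-1) ^ i * rf_t * rf_const (\<eta> N i ^ (2 * m * n))))" (is "?L = ?R")
proof (rule eq_matI)
  fix i j assume "i < dim_row ?R" "j < dim_col ?R"
  then have ij: "i < 2 * N" "j < 2 * N" by simp_all
  have v: "R ((Mu, True) # replicate n (X2, False)) = anti2 (w ^ (2 * m * n))"
    unfolding R_word
    by (simp add: power_inverse power_mult)
  have "?L $$ (i, j) = entry N ((Mu, True) # replicate n (X2, False)) i j"
    unfolding Phi_knot_fox_index[OF ij] lin_r2_eq
    by (simp add: fox_sum_append fox_sum_replicate_other)
  also have "\<dots> = ?R $$ (i, j)"
    using w0 ij by (subst entry_anti2[OF v]) (simp_all add: cross_index power_powi)
  finally show "?L $$ (i, j) = ?R $$ (i, j)" .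
qed (simp_all add: Phi_def)

text \<open>The prefix before the positive block of \<open>x2\<close> letters has eigenvalue
  \<open>w ^ (2 * m * n)\<close> times \<open>inverse w\<close>. By \<open>w_root\<close> this is
  the inverse of \<open>w ^ (2 * m * n)\<close>, so both blocks produce the same sum
  \<open>geo_inv\<close>, once per diagonal.\<close>

lemma Phi_fox_22:
  "Phi (2 * N) (sigma (2 * N) \<circ> \<rho>) (knot_fox m n (lin_r2 n) X2) =
   cross N (\<lambda>i. rf_const (geo_inv m n (\<eta> N i)))
     (\<lambda>i. (-1) ^ i * rf_t * rf_const (geo_inv m n (inverse (\<eta> N i))))" (is "?L = ?R")
proof (rule eq_matI)
  fix i j assume "i < dim_row ?R" "j < dim_col ?R"
  then have ij: "i < 2 * N" "j < 2 * N" by simp_all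
  have v1: "R ((Mu, True) # replicate (Suc a) (X2, False)) = anti2 (w ^ (2 * m * Suc a))" for a
    unfolding R_word
    by (simp only: power_inverse power_mult inverse_inverse_eq mult_1_left)
  have e1: "entry N ((Mu, True) # replicate (Suc a) (X2, False)) i j =
      (if i \<noteq> j \<and> i + j = 2 * N - 1 then - ((-1) ^ i * rf_t * rf_const (\<eta> N i ^ (2 * m * Suc a))) else 0)" for a
    using w0 ij by (subst entry_anti2[OF v1]) (simp_all add: power_powi del: mult_Suc_right)
  have v2: "R ((Mu, True) # replicate n (X2, False) @ (X1, True) # (Mu, False) # replicate a (X2, True))
      = diag2 (inverse w ^ (2 * m * Suc (n - Suc a)))" if "a < n" for a
  proof -
    have "R ((Mu, True) # replicate n (X2, False) @ (X1, True) # (Mu, False) # replicate a (X2, True))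
      = diag2 ((w ^ (2 * m)) ^ n * (w ^ (2 * m)) ^ a * inverse w)"
      unfolding R_word using w0 by (intro arg_cong[of _ _ diag2]) (simp add: field_simps)
    also have "(w ^ (2 * m)) ^ n * (w ^ (2 * m)) ^ a * inverse w = inverse w ^ (2 * m * Suc (n - Suc a))"
    proof -
      \<comment> \<open>\<open>Suc (n - Suc a)\<close> is \<open>n - a\<close>, written in the form
        to which the reversal of the summation index applies.\<close>
      have s: "Suc (n - Suc a) + a = n" using that by simp
      have "0 < m * n" using mn by simp
      then have "4 * m * n = Suc (4 * m * n - 1)" by simp
      then have "w ^ (4 * m * n) = w" using w_root by (metis mult_1 power_Suc2)
      moreover have "4 * m * n = 2 * m * n + 2 * m * (Suc (n - Suc a) + a)"
        unfolding s by simp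
      ultimately have "w ^ (2 * m * n) * (w ^ (2 * m * Suc (n - Suc a)) * w ^ (2 * m * a)) = w"
        by (simp only: power_add distrib_left)
      then show ?thesis using w0
        by (simp add: power_mult[symmetric] power_inverse field_simps del: mult_Suc_right)
    qed
    finally show ?thesis .
  qed
  have e2: "entry N ((Mu, True) # replicate n (X2, False) @ (X1, True) # (Mu, False) # replicate a (X2, True)) i j =
      (if i = j then rf_const (inverse (\<eta> N i) ^ (2 * m * Suc (n - Suc a))) else 0)" if "a < n" for a
    using w0 ij by (subst entry_diag2[OF v2[OF that]])
      (simp_all add: power_inverse inverse_powi power_powi del: mult_Suc_right)
  have "?L $$ (i, j) = - (\<Sum>a<n. entry N ((Mu, True) # replicate (Suc a) (X2, False)) i j)
     + (\<Sum>a<n. entry N ((Mu, True) # replicate n (X2, False) @ (X1, True) # (Mu, False) # replicate a (X2, True)) i j)"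
    unfolding Phi_knot_fox_index[OF ij] lin_r2_eq
    by (simp add: fox_sum_append fox_sum_replicate_pos fox_sum_replicate_neg del: replicate_Suc)
  also have "\<dots> = - (\<Sum>a<n. if i \<noteq> j \<and> i + j = 2 * N - 1 then - ((-1) ^ i * rf_t * rf_const (\<eta> N i ^ (2 * m * Suc a))) else 0)
     + (\<Sum>a<n. if i = j then rf_const (inverse (\<eta> N i) ^ (2 * m * Suc (n - Suc a))) else 0)"
    by (intro arg_cong2[where f = plus] arg_cong[where f = uminus] sum.cong HOL.refl)
      (simp_all add: e1 e2 del: replicate_Suc mult_Suc_right)
  also have "\<dots> = ?R $$ (i, j)"
    unfolding cross_index[OF ij] geo_inv_def rf_const_sum
      sum.nat_diff_reindex[of "\<lambda>a. rf_const (inverse (\<eta> N i) ^ (2 * m * Suc a))" n, symmetric]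
    by (simp add: sum_negf sum_distrib_left del: mult_Suc_right)
  finally show "?L $$ (i, j) = ?R $$ (i, j)" .
qed (simp_all add: Phi_def)

lemma Phi_one_minus_Mu:
  "Phi (2 * N) (sigma (2 * N) \<circ> \<rho>) (frag_of \<one>\<^bsub>knot_group m n\<^esub> - frag_of (knot_gen m n Mu)) =
   cross N (\<lambda>_. 1) (\<lambda>i. (-1) ^ i * rf_t)" (is "?L = ?R")
proof (rule eq_matI)
  fix i j assume "i < dim_row ?R" "j < dim_col ?R"
  then have ij: "i < 2 * N" "j < 2 * N" by simp_all
  have "?L $$ (i, j) = entry N [] i j - entry N [(Mu, True)] i j"
    using ij by (simp add: Phi_index int_linear_diff knot_group_def word_class_one knot_gen_def
        group_gen_def entry_def R_def)
  also have "entry N [] i j = (if i = j then 1 else 0)"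
    using ij by (subst entry_diag2[of _ 1]) (simp_all add: R_Nil diag2_1)
  also have "entry N [(Mu, True)] i j = (if i \<noteq> j \<and> i + j = 2 * N - 1 then - ((-1) ^ i * rf_t) else 0)"
    using ij by (subst entry_anti2[of _ 1]) (simp_all add: R_gens)
  also have "(if i = j then 1 else 0) - (if i \<noteq> j \<and> i + j = 2 * N - 1 then - ((-1) ^ i * rf_t) else 0) = ?R $$ (i, j)"
    unfolding cross_index[OF ij] by simp
  finally show "?L $$ (i, j) = ?R $$ (i, j)" .
qed (simp_all add: Phi_def)

lemma twisted_alexander_eq:
  "twisted_alexander m n (2 * N) (sigma (2 * N) \<circ> \<rho>) =
    (\<Prod>i<N. let x = \<eta> N i; y = inverse x in
      piece_det rf_t (rf_const (geo_inv m n x * x ^ m)) (rf_const (geo_inv m n y * y ^ m))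
        (rf_const (geo m x)) (rf_const (geo m y))
        (rf_const (y ^ (2 * m * n))) (rf_const (x ^ (2 * m * n)))) / (1 + rf_t\<^sup>2) ^ N"
proof -
  let ?r = "\<lambda>i. 2 * N - 1 - i"
  \<comment> \<open>The blocks are renamed so that reversing the index realizes
    \<open>\<eta> \<mapsto> inverse \<eta>\<close>. The inverse in \<open>f\<close> is there because
    row \<open>i\<close> of the lower left block holds \<open>f\<close> at the reversed
    index.\<close>
  define a where "a i = rf_const (geo m (\<eta> N i))" for i
  define c where "c i = rf_const (inverse (\<eta> N i) ^ m)" for i
  define e where "e i = rf_const (geo_inv m n (\<eta> N i))" for i
  define f where "f i = rf_const (inverse (\<eta> N i) ^ (2 * m * n))" for i
  have c: "c i * c (?r i) = 1" if "i < 2 * N" for i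
    unfolding c_def eta_reverse[OF that] rf_const_mult[symmetric] power_mult_distrib[symmetric]
    by simp
  have "det (four_block_mat
      (cross N (\<lambda>i. - rf_const (geo m (\<eta> N i)))
        (\<lambda>i. - ((-1) ^ i * rf_t * rf_const (geo m (inverse (\<eta> N i))))))
      (cross N (\<lambda>i. rf_const (inverse (\<eta> N i) ^ m)) (\<lambda>_. 0))
      (cross N (\<lambda>_. 0) (\<lambda>i. - ((-1) ^ i * rf_t * rf_const (\<eta> N i ^ (2 * m * n)))))
      (cross N (\<lambda>i. rf_const (geo_inv m n (\<eta> N i)))
        (\<lambda>i. (-1) ^ i * rf_t * rf_const (geo_inv m n (inverse (\<eta> N i))))))
    = det (four_block_mat
      (cross N (\<lambda>i. - a i) (\<lambda>i. - ((-1) ^ i * rf_t * a (?r i))))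
      (cross N c (\<lambda>_. 0))
      (cross N (\<lambda>_. 0) (\<lambda>i. - ((-1) ^ i * rf_t * f (?r i))))
      (cross N e (\<lambda>i. (-1) ^ i * rf_t * e (?r i))))"
    unfolding a_def c_def e_def f_def
    by (intro arg_cong[of _ _ det] cong_four_block_mat cross_cong) (simp_all only: eta_reverse inverse_inverse_eq)
  also have "\<dots> = (\<Prod>i<N. piece_det rf_t (e i * c (?r i)) (e (?r i) * c i) (a i) (a (?r i)) (f i) (f (?r i)))"
    by (rule det_cross_blocks[where a = a and c = c and e = e and f = f and z = rf_t, OF c])
  also have "\<dots> = (\<Prod>i<N. let x = \<eta> N i; y = inverse x in
      piece_det rf_t (rf_const (geo_inv m n x * x ^ m)) (rf_const (geo_inv m n y * y ^ m))
        (rf_const (geo m x)) (rf_const (geo m y))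
        (rf_const (y ^ (2 * m * n))) (rf_const (x ^ (2 * m * n))))"
  proof (rule prod.cong[OF HOL.refl])
    fix i assume "i \<in> {..<N}"
    then have i: "i < 2 * N" by simp
    show "piece_det rf_t (e i * c (?r i)) (e (?r i) * c i) (a i) (a (?r i)) (f i) (f (?r i)) =
      (let x = \<eta> N i; y = inverse x in
      piece_det rf_t (rf_const (geo_inv m n x * x ^ m)) (rf_const (geo_inv m n y * y ^ m))
        (rf_const (geo m x)) (rf_const (geo m y))
        (rf_const (y ^ (2 * m * n))) (rf_const (x ^ (2 * m * n))))"
      unfolding a_def c_def e_def f_def eta_reverse[OF i] Let_def rf_const_mult inverse_inverse_eq ..
  qed
  finally have num: "det (four_block_mat
      (cross N (\<lambda>i. - rf_const (geo m (\<eta> N i)))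
        (\<lambda>i. - ((-1) ^ i * rf_t * rf_const (geo m (inverse (\<eta> N i))))))
      (cross N (\<lambda>i. rf_const (inverse (\<eta> N i) ^ m)) (\<lambda>_. 0))
      (cross N (\<lambda>_. 0) (\<lambda>i. - ((-1) ^ i * rf_t * rf_const (\<eta> N i ^ (2 * m * n)))))
      (cross N (\<lambda>i. rf_const (geo_inv m n (\<eta> N i)))
        (\<lambda>i. (-1) ^ i * rf_t * rf_const (geo_inv m n (inverse (\<eta> N i)))))) = \<dots>" .
  have "det (cross N (\<lambda>_. 1) (\<lambda>i. (-1) ^ i * rf_t)) = (1 + rf_t\<^sup>2) ^ N"
  proof -
    have "1 * 1 - (-1) ^ i * rf_t * ((-1) ^ ?r i * rf_t) = 1 + rf_t\<^sup>2" if "i < N" for i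
    proof -
      have "odd (i + ?r i)" using that by simp
      then have "(-1) ^ i * (-1) ^ ?r i = (-1 :: ratfun)" unfolding power_add[symmetric] by simp
      moreover have "(-1) ^ i * rf_t * ((-1) ^ ?r i * rf_t) = ((-1) ^ i * (-1) ^ ?r i) * rf_t\<^sup>2"
        by (simp only: power2_eq_square mult_ac)
      ultimately have "(-1) ^ i * rf_t * ((-1) ^ ?r i * rf_t) = - (rf_t\<^sup>2)" by simp
      then show ?thesis by simp
    qed
    then have "(\<Prod>i<N. 1 * 1 - (-1) ^ i * rf_t * ((-1) ^ ?r i * rf_t)) = (\<Prod>i<N. 1 + rf_t\<^sup>2)"
      by (intro prod.cong) simp_all
    then show ?thesis unfolding det_cross by simp
  qed
  then show ?thesis
    unfolding twisted_alexander_def Phi_fox_11 Phi_fox_12 Phi_fox_21 Phi_fox_22 Phi_one_minus_Mu num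
    by (rule arg_cong)
qed

end

section \<open>Evaluation of the twisted Alexander polynomial at a number\<close>

lemma rf_eval_fraction:
  assumes "poly s z \<noteq> 0"
  shows "rf_eval (to_fract p / to_fract s) z = poly p z / poly s z"
proof -
  define r where "r = to_fract p / to_fract s"
  define u where "u = fst (quot_of_fract r)"
  define v where "v = snd (quot_of_fract r)"
  have s0: "s \<noteq> 0" using assms by auto
  have v0: "v \<noteq> 0" by (simp add: v_def)
  have cop: "coprime u v" unfolding u_def v_def by (rule coprime_quot_of_fract)
  have "to_fract u / to_fract v = to_fract p / to_fract s"
    unfolding u_def v_def Fract_conv_to_fract[symmetric] Fract_quot_of_fract
    by (simp only: r_def Fract_conv_to_fract)
  then have "to_fract (u * s) = to_fract (p * v)"
    using s0 v0 by (simp add: frac_eq_eq)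
  then have eq: "poly u z * poly s z = poly p z * poly v z"
    by (metis to_fract_eq_iff poly_mult)
  \<comment> \<open>If the reduced denominator vanished at \<open>z\<close>, the cross-multiplied
    equation would make the reduced numerator vanish too, against coprimality.\<close>
  have "poly v z \<noteq> 0"
  proof
    assume "poly v z = 0"
    moreover from this have "poly u z = 0" using eq assms by simp
    ultimately have "[:- z, 1:] dvd u" "[:- z, 1:] dvd v" by (simp_all add: poly_eq_0_iff_dvd)
    then have "is_unit [:- z, 1:]" by (rule coprime_common_divisor[OF cop])
    then show False by (simp add: is_unit_pCons_iff)
  qed
  then show ?thesis
    using eq assms by (simp add: rf_eval_def r_def[symmetric] u_def[symmetric] v_def[symmetric] field_simps)
qed

lemma poly_piece_det: "poly (piece_det p g g' a a' f f') z =
    piece_det (poly p z) (poly g z) (poly g' z) (poly a z) (poly a' z) (poly f z) (poly f' z)"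
  by (simp add: piece_det_def)

lemma to_fract_piece_det: "to_fract (piece_det p g g' a a' f f') =
    piece_det (to_fract p) (to_fract g) (to_fract g') (to_fract a) (to_fract a') (to_fract f) (to_fract f')"
  by (simp add: piece_det_def power2_eq_square)

lemma to_fract_prod: "to_fract (prod f A) = (\<Prod>x\<in>A. to_fract (f x))"
  by (induction A rule: infinite_finite_induct) simp_all

lemma to_fract_power: "to_fract (p ^ k) = to_fract p ^ k"
  by (induction k) simp_all

definition knot_factor :: "nat \<Rightarrow> nat \<Rightarrow> complex \<Rightarrow> complex \<Rightarrow> complex" where
  "knot_factor m n z x = (let y = inverse x in
     piece_det z (geo_inv m n x * x ^ m) (geo_inv m n y * y ^ m) (geo m x) (geo m y)
       (y ^ (2 * m * n)) (x ^ (2 * m * n)))"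

lemma (in lin_rep) rf_eval_twisted_alexander:
  assumes "1 + z\<^sup>2 \<noteq> 0"
  shows "rf_eval (twisted_alexander m n (2 * N) (sigma (2 * N) \<circ> \<rho>)) z =
    (\<Prod>i<N. knot_factor m n z (\<eta> N i) / (1 + z\<^sup>2))"
proof -
  \<comment> \<open>The piece as a polynomial in \<open>t\<close> with constant coefficients, so
    that the whole invariant is a quotient of two polynomials.\<close>
  define P where "P x = (let y = inverse x in
     piece_det [:0, 1:] [:geo_inv m n x * x ^ m:] [:geo_inv m n y * y ^ m:] [:geo m x:] [:geo m y:]
       [:y ^ (2 * m * n):] [:x ^ (2 * m * n):])" for x :: complex
  have "twisted_alexander m n (2 * N) (sigma (2 * N) \<circ> \<rho>) =
      to_fract (\<Prod>i<N. P (\<eta> N i)) / to_fract ((1 + [:0, 1:]\<^sup>2) ^ N)"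
    unfolding twisted_alexander_eq
    by (simp add: P_def to_fract_prod to_fract_piece_det to_fract_power Let_def rf_const_def rf_t_def)
  moreover have "rf_eval (to_fract (\<Prod>i<N. P (\<eta> N i)) / to_fract ((1 + [:0, 1:]\<^sup>2) ^ N)) z
      = poly (\<Prod>i<N. P (\<eta> N i)) z / poly ((1 + [:0, 1:]\<^sup>2) ^ N) z"
    by (rule rf_eval_fraction) (use assms in simp)
  ultimately show ?thesis
    by (simp add: poly_prod P_def knot_factor_def poly_piece_det Let_def prod_dividef)
qed

section \<open>Periodic means and roots of unity\<close>

text \<open>The partial sums \<open>D\<close> of the deviations from the mean over one period are
  themselves periodic, hence bounded, so dividing by \<open>N\<close> sends them to 0.\<close>

lemma periodic_mean:
  fixes u :: "nat \<Rightarrow> real"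
  assumes "0 < q" and per: "\<And>j. u (j + q) = u j"
  shows "(\<lambda>N. (\<Sum>j<N. u j) / real N) \<longlonglongrightarrow> (\<Sum>j<q. u j) / real q"
proof -
  define \<mu> where "\<mu> = (\<Sum>j<q. u j) / real q"
  define D where "D N = (\<Sum>j<N. u j - \<mu>)" for N
  have "D q = 0"
    using \<open>0 < q\<close> by (simp add: D_def sum_subtractf \<mu>_def)
  have D_per: "D (N + q) = D N" for N
  proof (induction N)
    case 0
    then show ?case using \<open>D q = 0\<close> by (simp add: D_def)
  next
    case (Suc N)
    have "D (Suc (N + q)) = D (N + q) + (u (N + q) - \<mu>)" by (simp add: D_def)
    also have "\<dots> = D (Suc N)" using Suc per by (simp add: D_def)
    finally show ?case by simp
  qed
  have D_per': "D (N + k * q) = D N" for N k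
    by (induction k) (simp_all add: D_per add.assoc[symmetric] add.commute[of q])
  have "D N = D (N mod q)" for N
    using D_per'[of "N mod q" "N div q"] by simp
  moreover have "\<bar>D k\<bar> \<le> (\<Sum>j<q. \<bar>D j\<bar>)" if "k < q" for k
    using that by (intro member_le_sum) auto
  ultimately have bound: "\<bar>D N\<bar> \<le> (\<Sum>j<q. \<bar>D j\<bar>)" for N
    using \<open>0 < q\<close> by (metis mod_less_divisor)
  have "(\<lambda>N. D N / real N) \<longlonglongrightarrow> 0"
  proof (rule Lim_null_comparison)
    show "\<forall>\<^sub>F N in sequentially. norm (D N / real N) \<le> (\<Sum>j<q. \<bar>D j\<bar>) / real N"
      using bound by (intro always_eventually allI) (simp add: divide_right_mono)
    show "(\<lambda>N. (\<Sum>j<q. \<bar>D j\<bar>) / real N) \<longlonglongrightarrow> 0"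
      by (rule lim_const_over_n)
  qed
  then have "(\<lambda>N. \<mu> + D N / real N) \<longlonglongrightarrow> \<mu> + 0"
    by (intro tendsto_add tendsto_const)
  moreover have "\<forall>\<^sub>F N in sequentially. \<mu> + D N / real N = (\<Sum>j<N. u j) / real N"
    using eventually_gt_at_top[of 0] by eventually_elim (simp add: D_def sum_subtractf field_simps)
  ultimately show ?thesis
    unfolding \<mu>_def[symmetric] by (simp add: Lim_transform_eventually)
qed

text \<open>The map from \<open>j\<close> to \<open>2 * s * j + s\<close> is affine with invertible
  slope modulo \<open>q\<close>, hence permutes the residues.\<close>

lemma sum_odd_multiples_mod:
  fixes h :: "nat \<Rightarrow> 'a::comm_monoid_add"
  assumes "0 < q" "coprime (2 * s) q"
  shows "(\<Sum>j<q. h ((s * (2 * j + 1)) mod q)) = sum h {..<q}"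
proof -
  let ?f = "\<lambda>j. s * (2 * j + 1) mod q"
  have "inj_on ?f {..<q}"
  proof (rule inj_onI)
    fix j k assume jk: "j \<in> {..<q}" "k \<in> {..<q}" "?f j = ?f k"
    then have "[2 * s * j + s = 2 * s * k + s] (mod q)"
      by (simp add: cong_def algebra_simps)
    then have "[2 * s * j = 2 * s * k] (mod q)" by (simp only: cong_add_rcancel_nat)
    then have "[j = k] (mod q)" using assms(2) by (simp add: cong_mult_lcancel_nat)
    then show "j = k" using jk by (simp add: cong_def)
  qed
  moreover have "?f ` {..<q} \<subseteq> {..<q}" using assms(1) by auto
  ultimately have "bij_betw ?f {..<q} {..<q}"
    by (metis bij_betw_def endo_inj_surj finite_lessThan)
  then show ?thesis by (rule sum.reindex_bij_betw)
qed

section \<open>Closed forms of the geometric sums and the factor of one piece\<close>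

lemma geo_closed: "x \<noteq> 1 \<Longrightarrow> geo m x = (1 - x ^ m) / (1 - x)"
  by (simp add: geo_def sum_gp_strict)

lemma geo_inv_closed:
  fixes x :: complex
  assumes "x \<noteq> 0" "x ^ (2 * m) \<noteq> 1"
  shows "geo_inv m n x = (1 - inverse (x ^ (2 * m * n))) / (x ^ (2 * m) - 1)"
proof -
  let ?y = "inverse (x ^ (2 * m))"
  have y: "?y \<noteq> 1" using assms by (metis inverse_1 inverse_inverse_eq)
  have "geo_inv m n x = (\<Sum>b<n. ?y * ?y ^ b)"
    unfolding geo_inv_def by (rule sum.cong) (simp_all only: power_inverse power_mult power_Suc)
  also have "\<dots> = ?y * ((1 - ?y ^ n) / (1 - ?y))"
    using y by (simp add: sum_distrib_left[symmetric] sum_gp_strict)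
  also have "?y ^ n = inverse (x ^ (2 * m * n))" by (simp add: power_inverse power_mult)
  also have "?y * ((1 - inverse (x ^ (2 * m * n))) / (1 - ?y)) =
      (1 - inverse (x ^ (2 * m * n))) / (x ^ (2 * m) - 1)"
    using assms y by (simp add: divide_simps)
  finally show ?thesis .
qed

text \<open>At \<open>x = 1\<close> the sums \<open>geo\<close> and \<open>geo_inv\<close> reduce to
  their numbers of terms, \<open>m\<close> and \<open>n\<close>.\<close>

lemma knot_factor_1:
  "knot_factor m n z 1 = (of_nat m)\<^sup>2 * (of_nat n)\<^sup>2 * (1 - z\<^sup>2)\<^sup>2 + z\<^sup>2 * (2 * of_nat m * of_nat n - 1)\<^sup>2"
proof -
  have "knot_factor m n z 1 = piece_det z (of_nat n) (of_nat n) (of_nat m) (of_nat m) 1 1"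
    by (simp add: knot_factor_def geo_def geo_inv_def Let_def)
  also have "piece_det z b b a a 1 1 = a\<^sup>2 * b\<^sup>2 * (1 - z\<^sup>2)\<^sup>2 + z\<^sup>2 * (2 * a * b - 1)\<^sup>2" for a b :: complex
  proof -
    have eq: "b - z\<^sup>2 * b = (1 - z\<^sup>2) * b" by (simp only: left_diff_distrib mult_1_left)
    have "(b - z\<^sup>2 * b) * (b - z\<^sup>2 * b) * (a * a) = a\<^sup>2 * b\<^sup>2 * (1 - z\<^sup>2)\<^sup>2"
      unfolding eq by (simp only: power2_eq_square[of a] power2_eq_square[of b]
        power2_eq_square[of "1 - z\<^sup>2"] mult_ac)
    moreover have "((b + b) * a - 1) * ((b + b) * a - 1) = (2 * a * b - 1)\<^sup>2"
      by (simp only: power2_eq_square mult_2[symmetric] mult_ac)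
    ultimately show ?thesis by (simp only: piece_det_def)
  qed
  finally show ?thesis .
qed

definition root_norm :: "complex \<Rightarrow> nat \<Rightarrow> real" where
  "root_norm x s = cmod (1 - x ^ s)"

text \<open>With \<open>D = 1 - v * v\<close> and \<open>E = 1 - z * z\<close>, the first factor is
  \<open>v * E / (z * D)\<close> and the second is its reciprocal.\<close>

lemma geometric_sums_cancel:
  fixes v z :: "'a::field"
  assumes "v \<noteq> 0" "z \<noteq> 0" "v * v \<noteq> 1" "z * z \<noteq> 1"
  shows "((1 - inverse z) / (v * v - 1) * v + (1 - z) / (inverse (v * v) - 1) * inverse v) *
    ((1 - inverse v) / (1 - inverse (z * z)) * inverse z + (1 - v) / (1 - z * z) * z) = 1"
proof -
  define D where "D = 1 - v * v"
  define E where "E = 1 - z * z"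
  have nz: "D \<noteq> 0" "E \<noteq> 0" using assms by (simp_all add: D_def E_def)
  have inv: "1 - inverse x = - (1 - x) / x" "inverse x - 1 = (1 - x) / x" if "x \<noteq> 0" for x :: 'a
    using that by (simp_all add: divide_inverse left_diff_distrib)
  have vv: "v * v \<noteq> 0" "z * z \<noteq> 0" using assms by simp_all
  have D': "v * v - 1 = - D" by (simp add: D_def)
  have 1: "(1 - inverse z) / (v * v - 1) * v = (1 - z) * (v / (z * D))"
  proof -
    have "- k / z / - D * v = k * (v / (z * D))" for k by simp
    then show ?thesis unfolding inv(1)[OF assms(2)] D' .
  qed
  have 2: "(1 - z) / (inverse (v * v) - 1) * inverse v = (1 - z) * (v / (z * D)) * z"
    unfolding inv(2)[OF vv(1)] D_def[symmetric] using assms(1,2) by (simp add: divide_inverse)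
  have 3: "(1 - inverse v) / (1 - inverse (z * z)) * inverse z = (1 - v) * (z / (v * E))"
  proof -
    have "- k / v / (- E / (z * z)) * inverse z = k * (z / (v * E))" for k
      using assms(1,2) by (simp add: divide_inverse)
    then show ?thesis unfolding inv(1)[OF vv(2)] inv(1)[OF assms(1)] E_def[symmetric] .
  qed
  have 4: "(1 - v) / (1 - z * z) * z = (1 - v) * (z / (v * E)) * v"
    unfolding E_def[symmetric] using assms(1) by (simp add: divide_inverse)
  have 5: "(1 - z) * x + (1 - z) * x * z = E * x" for x
    by (simp add: E_def left_diff_distrib)
  have 6: "(1 - v) * x + (1 - v) * x * v = D * x" for x
    by (simp add: D_def left_diff_distrib)
  show ?thesis
    unfolding 1 2 3 4 5 6 using assms nz by simp
qed

text \<open>In terms of \<open>\<zeta> = x\<^sup>2\<^sup>m\<^sup>n\<close>, a square root of \<open>x\<close>, the identity above makes the coefficient of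
  \<open>z\<^sup>2\<close> equal to \<open>2 g g' a a'\<close>, so the factor becomes a perfect square times a constant.\<close>

lemma knot_factor_root:
  assumes "0 < m" "0 < n" and root: "x ^ (4 * m * n - 1) = 1" and x1: "x \<noteq> 1"
  shows "x ^ m \<noteq> 1" "x ^ (2 * m) \<noteq> 1" "x ^ (2 * m * n) \<noteq> 1"
    and "knot_factor m n z x = of_real
      ((root_norm x m * root_norm x (2 * m * n) / (root_norm x 1 * root_norm x (2 * m)))\<^sup>2) * (1 + z\<^sup>2)\<^sup>2"
proof -
  have "0 < m * n" using assms by simp
  then have Suc: "4 * m * n = Suc (4 * m * n - 1)" by simp
  have full: "x ^ (4 * m * n) = x"
    using root Suc by (metis mult_1 power_Suc2)
  have exponent: "4 * m * n - 1 \<noteq> 0"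
  proof -
    have "4 * m * n = 4 * (m * n)" by simp
    then show ?thesis using \<open>0 < m * n\<close> by linarith
  qed
  have x0: "x \<noteq> 0"
    using root exponent by (metis power_0_left zero_neq_one)
  have norm_x: "cmod x = 1"
    using power_eq_1_iff[OF root] exponent by simp
  have 2: "x ^ (2 * m) \<noteq> 1"
  proof
    assume "x ^ (2 * m) = 1"
    then have "(x ^ (2 * m)) ^ (2 * n) = 1" by simp
    then have "x ^ (4 * m * n) = 1" by (simp flip: power_mult add: mult_ac)
    then show False using full x1 by simp
  qed
  show "x ^ (2 * m) \<noteq> 1" by fact
  show m1: "x ^ m \<noteq> 1" using 2 by (metis mult.commute power_mult power_one)
  define \<zeta> where "\<zeta> = x ^ (2 * m * n)"
  \<comment> \<open>\<open>w * w = x ^ m\<close> takes the role of \<open>v\<close> in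
    \<open>geometric_sums_cancel\<close>, and \<zeta> that of \<open>z\<close>.\<close>
  define w where "w = \<zeta> ^ m"
  have z2: "\<zeta> * \<zeta> = x"
  proof -
    have e: "2 * m * n + 2 * m * n = 4 * m * n" by simp
    show ?thesis unfolding \<zeta>_def power_add[symmetric] e by (rule full)
  qed
  show zeta1: "x ^ (2 * m * n) \<noteq> 1" using z2 x1 unfolding \<zeta>_def[symmetric] by auto
  have xm: "x ^ m = w * w" unfolding w_def z2[symmetric] by (simp add: power_mult_distrib)
  have x2m: "x ^ (2 * m) = w * w * (w * w)" by (simp only: mult_2 power_add xm)
  have nz: "\<zeta> \<noteq> 0" "w \<noteq> 0" using x0 by (simp_all add: \<zeta>_def w_def)
  have w4: "w * w * (w * w) \<noteq> 1" using 2 x2m by simp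
  have zz: "\<zeta> * \<zeta> \<noteq> 1" using z2 x1 by simp
  define y where "y = inverse x"
  have y0: "y \<noteq> 0" "y \<noteq> 1" using x0 x1 by (auto simp: y_def)
  have ym: "y ^ m = inverse (w * w)" "y ^ (2 * m) = inverse (w * w * (w * w))" "y ^ (2 * m * n) = inverse \<zeta>"
    by (simp_all only: y_def power_inverse xm x2m \<zeta>_def[symmetric])
  define a a' g g' where "a = geo m x" and "a' = geo m y"
    and "g = geo_inv m n x * x ^ m" and "g' = geo_inv m n y * y ^ m"
  have a: "a = (1 - w * w) / (1 - \<zeta> * \<zeta>)"
    unfolding a_def using geo_closed[OF x1, of m] by (simp only: xm z2)
  have a': "a' = (1 - inverse (w * w)) / (1 - inverse (\<zeta> * \<zeta>))"
    unfolding a'_def geo_closed[OF y0(2)] ym z2 y_def[symmetric] ..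
  have y2: "y ^ (2 * m) \<noteq> 1" unfolding ym using w4 by (metis inverse_1 inverse_inverse_eq)
  have g': "g' = (1 - \<zeta>) / (inverse (w * w * (w * w)) - 1) * inverse (w * w)"
    unfolding g'_def geo_inv_closed[OF y0(1) y2] ym inverse_inverse_eq ..
  have g: "g = (1 - inverse \<zeta>) / (w * w * (w * w) - 1) * (w * w)"
    unfolding g_def using geo_inv_closed[OF x0 2, of n] by (simp only: xm x2m \<zeta>_def[symmetric])
  have sum: "(g + g') * (a' * inverse \<zeta> + a * \<zeta>) = 1"
    unfolding g g' a a' by (rule geometric_sums_cancel) (use nz w4 zz in simp_all)
  \<comment> \<open>By \<open>sum\<close> the middle term cancels the constant 1 coming from
    \<open>\<zeta> * inverse \<zeta>\<close>. What remains,
    \<open>(g + g')\<^sup>2 * (a * a')\<close>, completes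
    \<open>(g - z\<^sup>2 * g') * (g' - z\<^sup>2 * g)\<close> to
    \<open>g * g' * (1 + z\<^sup>2)\<^sup>2\<close>.\<close>
  have cross: "((g + g') * a' - \<zeta>) * ((g + g') * a - inverse \<zeta>) = (g + g')\<^sup>2 * (a * a') - (g + g') * (a' * inverse \<zeta> + a * \<zeta>) + 1"
    using nz by (simp add: algebra_simps power2_eq_square)
  have "knot_factor m n z x = piece_det z g g' a a' (inverse \<zeta>) \<zeta>"
    unfolding knot_factor_def Let_def g_def g'_def a_def a'_def y_def \<zeta>_def power_inverse ..
  also have "\<dots> = (g * g' * (a * a')) * (1 + z\<^sup>2)\<^sup>2"
    unfolding piece_det_def cross sum by (simp add: power2_eq_square algebra_simps)
  also have "g * g' * (a * a') = of_real
      ((root_norm x m * root_norm x (2 * m * n) / (root_norm x 1 * root_norm x (2 * m)))\<^sup>2)"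
  proof -
    \<comment> \<open>On the unit circle inversion is conjugation, so the primed sums are conjugates
      and the constant is a squared modulus.\<close>
    have y_cnj: "y = cnj x"
      unfolding y_def by (rule inverse_unique) (simp add: complex_norm_square[symmetric] norm_x)
    have "a' = cnj a" by (simp add: a_def a'_def geo_def y_cnj)
    moreover have "g' = cnj g" by (simp add: g_def g'_def geo_inv_def y_cnj)
    ultimately have "g * g' * (a * a') = of_real ((cmod g * cmod a)\<^sup>2)"
      by (simp only: complex_norm_square[symmetric] power_mult_distrib of_real_mult)
    moreover have "cmod a = root_norm x m / root_norm x 1"
      unfolding a_def geo_closed[OF x1] by (simp add: norm_divide root_norm_def)
    moreover have "cmod g = root_norm x (2 * m * n) / root_norm x (2 * m)"
    proof -
      have n\<zeta>: "cmod \<zeta> = 1" by (simp add: \<zeta>_def norm_power norm_x)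
      have "1 - inverse \<zeta> = - inverse \<zeta> * (1 - \<zeta>)" using nz by (simp add: algebra_simps)
      then have "cmod (1 - inverse \<zeta>) = cmod (1 - \<zeta>)"
        by (simp add: norm_mult norm_inverse n\<zeta>)
      then show ?thesis
        unfolding g_def geo_inv_closed[OF x0 2]
        by (simp add: norm_mult norm_divide norm_power norm_x root_norm_def \<zeta>_def norm_minus_commute)
    qed
    ultimately show ?thesis by (simp add: mult.commute)
  qed
  finally show "knot_factor m n z x = of_real
      ((root_norm x m * root_norm x (2 * m * n) / (root_norm x 1 * root_norm x (2 * m)))\<^sup>2) * (1 + z\<^sup>2)\<^sup>2" .
qed

section \<open>Orders of powers of roots of unity, and logarithms of positive products\<close>

lemma exp_root_power_eq_1_iff:
  assumes "1 \<le> M"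
  shows "exp (2 * of_real pi * \<i> / of_nat M) ^ k = 1 \<longleftrightarrow> M dvd k"
proof -
  have "exp (2 * of_real pi * \<i> / of_nat M) ^ k = exp (2 * of_real pi * \<i> * of_nat k / of_nat M)"
    by (simp add: exp_of_nat_mult[symmetric] mult_ac)
  then show ?thesis using complex_root_unity_eq_1[OF assms] by simp
qed

text \<open>After cancelling the gcd, the remaining cofactor of \<open>i\<close> is coprime to the
  modulus. Applied to exponents, this makes \<open>q\<close> the order of
  \<open>\<xi> ^ i\<close>.\<close>

lemma dvd_mult_iff_div_gcd_dvd:
  fixes M i k :: nat
  assumes "0 < M"
  shows "M dvd i * k \<longleftrightarrow> M div gcd M i dvd k"
proof -
  let ?g = "gcd M i"
  have g: "0 < ?g" using assms by simp
  have "M = ?g * (M div ?g)" "i = ?g * (i div ?g)" by simp_all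
  then have "M dvd i * k \<longleftrightarrow> ?g * (M div ?g) dvd ?g * (i div ?g * k)"
    by (metis mult.assoc)
  also have "\<dots> \<longleftrightarrow> M div ?g dvd i div ?g * k"
    by (rule nat_mult_dvd_cancel1[OF g])
  also have "\<dots> \<longleftrightarrow> M div ?g dvd k"
    using assms by (intro coprime_dvd_mult_right_iff div_gcd_coprime) simp
  finally show ?thesis .
qed

text \<open>The product is a positive real, where the principal complex logarithm is the real one,
  so no multiple of \<open>2 * pi * \<i>\<close> arises in splitting it.\<close>

lemma ln_prod_of_real:
  fixes v :: "nat \<Rightarrow> real"
  assumes "\<And>j. j < N \<Longrightarrow> 0 < v j"
  shows "ln (\<Prod>j<N. of_real (v j) :: complex) = of_real (\<Sum>j<N. ln (v j))"
proof -
  have "ln (\<Prod>j<N. of_real (v j) :: complex) = ln (of_real (\<Prod>j<N. v j))" by simp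
  also have "\<dots> = of_real (ln (\<Prod>j<N. v j))"
    by (rule Ln_of_real) (use assms in \<open>auto intro: prod_pos\<close>)
  also have "ln (\<Prod>j<N. v j) = (\<Sum>j<N. ln (v j))"
  proof (rule ln_prod)
    fix j assume "j \<in> {..<N}"
    then show "v j \<noteq> 0" using assms[of j] by simp
  qed simp
  finally show ?thesis .
qed

section \<open>The limit as a mean over one period\<close>

theorem theorem4p4:
  fixes m n i :: nat and \<xi> :: complex and \<rho> :: "gen word set \<Rightarrow> complex mat"
    and q :: nat and t :: real
  assumes "0 < m" and "0 < n"
    and "\<xi> = exp (2 * of_real pi * \<i> / (4 * of_nat m * of_nat n - 1))"
    and "1 \<le> i" and "i \<le> 2 * m * n - 1"
    and "\<rho> \<in> hom (knot_group m n) (SL 2)"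
    and "irreducible_rep (knot_group m n) 2 \<rho>"
    and "metabelian_rep (knot_group m n) \<rho>"
    and "\<rho> (knot_gen m n X1) = mat_of_rows_list 2 [[\<xi> ^ i, 0], [0, inverse (\<xi> ^ i)]]"
    and "\<rho> (knot_gen m n X2) =
           mat_of_rows_list 2 [[\<xi> ^ (2 * m * i), 0], [0, inverse (\<xi> ^ (2 * m * i))]]"
    and "\<rho> (knot_gen m n Mu) = mat_of_rows_list 2 [[0, 1], [-1, 0]]"
    and "q = (4 * m * n - 1) div gcd (4 * m * n - 1) i"
  shows "(\<lambda>N. ln (rf_eval (twisted_alexander m n (2 * N) (sigma (2 * N) \<circ> \<rho>)) (of_real t))
              / of_nat (2 * N))
         \<longlonglongrightarrow> of_real
           (1 / (2 * real q) *
              ln (((real m)\<^sup>2 * (real n)\<^sup>2 * t ^ 4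
                   + (2 * (real m)\<^sup>2 * (real n)\<^sup>2 - 4 * real m * real n + 1) * t\<^sup>2
                   + (real m)\<^sup>2 * (real n)\<^sup>2) / (t\<^sup>2 + 1)\<^sup>2)
            + 1 / 2 * ln (t\<^sup>2 + 1))"
proof -
  define M where "M = 4 * m * n - 1"
  have mn: "1 \<le> m * n" using assms(1,2) by simp
  have M: "4 * m * n = Suc M" "0 < M"
  proof -
    have "4 * m * n = 4 * (m * n)" by simp
    then show "4 * m * n = Suc M" "0 < M" using mn unfolding M_def by linarith+
  qed
  have "of_nat M = (4 * of_nat m * of_nat n - 1 :: complex)"
    using arg_cong[OF M(1), of "of_nat :: nat \<Rightarrow> complex"] by (simp add: algebra_simps)
  then have xi: "\<xi> = exp (2 * of_real pi * \<i> / of_nat M)" using assms(3) by simp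
  define \<omega> where "\<omega> = \<xi> ^ i"
  have omega_power: "\<omega> ^ k = 1 \<longleftrightarrow> q dvd k" for k
    using exp_root_power_eq_1_iff[of M "i * k"] dvd_mult_iff_div_gcd_dvd[of M i k] M(2) assms(12)
    by (simp add: \<omega>_def xi M_def power_mult)
  have "M = gcd M i * q" unfolding assms(12) M_def[symmetric] by simp
  then have q_dvd: "q dvd M" by (metis dvd_triv_right)
  have q0: "0 < q" using q_dvd M(2) by (metis dvd_0_left_iff gr0I less_irrefl)
  have omega_M: "\<omega> ^ (4 * m * n - 1) = 1"
    using q_dvd by (simp add: omega_power M_def)
  have omega_mod: "\<omega> ^ (k mod q) = \<omega> ^ k" for k
  proof -
    have "\<omega> ^ k = \<omega> ^ (q * (k div q) + k mod q)" by simp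
    also have "\<dots> = (\<omega> ^ q) ^ (k div q) * \<omega> ^ (k mod q)" by (simp only: power_add power_mult)
    finally show ?thesis using omega_power[of q] by simp
  qed
  have w0: "\<omega> \<noteq> 0" by (simp add: \<omega>_def xi)
  have X1: "\<rho> (knot_gen m n X1) = diag2 \<omega>"
    using assms(9) unfolding diag2_def \<omega>_def .
  have "\<xi> ^ (2 * m * i) = \<omega> ^ (2 * m)"
    unfolding \<omega>_def by (metis mult.commute power_mult)
  then have X2: "\<rho> (knot_gen m n X2) = diag2 (\<omega> ^ (2 * m))"
    using assms(10) by (simp only: diag2_def)
  have Mu: "\<rho> (knot_gen m n Mu) = anti2 1"
    using assms(11) by (simp only: anti2_def inverse_1)
  note rep = lin_rep.intro[OF assms(1,2) w0 omega_M assms(6) X1 X2 Mu]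
  define \<eta> where "\<eta> N k = \<omega> powi (2 * int N - 1 - 2 * int k)" for N k

  define S where "S = (real m)\<^sup>2 * (real n)\<^sup>2 * (1 - t\<^sup>2)\<^sup>2 + t\<^sup>2 * (2 * real m * real n - 1)\<^sup>2"
  \<comment> \<open>The first summand vanishes only for \<open>t\<^sup>2 = 1\<close>, and there the
    second is the square of the nonzero number \<open>2 * m * n - 1\<close>.\<close>
  have S_pos: "0 < S"
  proof (cases "t\<^sup>2 = 1")
    case True
    have "1 \<le> real m * real n" using mn by (metis of_nat_1 of_nat_le_iff of_nat_mult)
    then show ?thesis using True by (simp add: S_def)
  next
    case False
    then have "0 < (real m)\<^sup>2 * (real n)\<^sup>2 * (1 - t\<^sup>2)\<^sup>2" using assms(1,2) by simp
    then show ?thesis unfolding S_def by (intro add_pos_nonneg) simp_all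
  qed
  have T_pos: "0 < 1 + t\<^sup>2" by (simp add: add_pos_nonneg)
  \<comment> \<open>Since \<open>ln 0 = 0\<close>, \<open>L\<close> vanishes at \<open>0\<close>, so that \<open>u\<close> needs no case distinction in the \<open>L\<close> terms.\<close>
  define L where "L r = ln (cmod (1 - \<omega> ^ r))" for r
  define v where "v j = (let k = 2 * j + 1 in (if q dvd k then S else
      (root_norm (\<omega> ^ k) m * root_norm (\<omega> ^ k) (2 * m * n)
        / (root_norm (\<omega> ^ k) 1 * root_norm (\<omega> ^ k) (2 * m)))\<^sup>2 * (1 + t\<^sup>2)\<^sup>2) / (1 + t\<^sup>2))" for j
  \<comment> \<open>\<open>h\<close> joins the contribution of the multiplier 1, which is
    \<open>- 2 * L\<close>, to the logarithm of \<open>S / (1 + t\<^sup>2)\<close> at residue 0 and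
    of \<open>1 + t\<^sup>2\<close> elsewhere. Every term of \<open>u\<close> then depends only on a
    multiple of \<open>2 * j + 1\<close> modulo \<open>q\<close>.\<close>
  define h where "h r = (if r = 0 then ln S - ln (1 + t\<^sup>2) else ln (1 + t\<^sup>2)) - 2 * L r" for r
  define u where "u j = h ((1 * (2 * j + 1)) mod q) + 2 * L ((m * (2 * j + 1)) mod q)
      + 2 * L ((2 * m * n * (2 * j + 1)) mod q) - 2 * L ((2 * m * (2 * j + 1)) mod q)" for j

  have factor: "knot_factor m n (of_real t) (\<omega> ^ (2 * j + 1)) / (1 + (of_real t)\<^sup>2) = of_real (v j)"
    and v_pos: "0 < v j" and ln_v: "ln (v j) = u j" for j
  proof -
    let ?k = "2 * j + 1"
    have L_mult: "L ((s * ?k) mod q) = ln (root_norm (\<omega> ^ ?k) s)" for s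
    proof -
      have "\<omega> ^ (s * ?k) = (\<omega> ^ ?k) ^ s" by (metis mult.commute power_mult)
      then show ?thesis unfolding L_def root_norm_def omega_mod by (rule arg_cong)
    qed
    have "knot_factor m n (of_real t) (\<omega> ^ ?k) / (1 + (of_real t)\<^sup>2) = of_real (v j) \<and> 0 < v j \<and> ln (v j) = u j"
    proof (cases "q dvd ?k")
      case True
      have x1: "\<omega> ^ ?k = 1" using omega_power True by blast
      have v: "v j = S / (1 + t\<^sup>2)" unfolding v_def Let_def by (rule if_P[OF True, THEN arg_cong])
      have "(s * ?k) mod q = 0" for s by (rule dvd_imp_mod_0[OF dvd_mult[OF True]])
      then have "u j = ln S - ln (1 + t\<^sup>2)" by (simp only: u_def h_def L_def) simp
      moreover have "knot_factor m n (of_real t) 1 = of_real S"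
        unfolding knot_factor_1 S_def by simp
      ultimately show ?thesis
        unfolding x1 v using S_pos T_pos by (simp add: ln_div)
    next
      case False
      define c where "c = root_norm (\<omega> ^ ?k) m * root_norm (\<omega> ^ ?k) (2 * m * n)
        / (root_norm (\<omega> ^ ?k) 1 * root_norm (\<omega> ^ ?k) (2 * m))"
      have x1: "\<omega> ^ ?k \<noteq> 1" using False omega_power by blast
      have root: "(\<omega> ^ ?k) ^ (4 * m * n - 1) = 1"
        using omega_M by (metis power_commutes power_mult mult.commute power_one)
      note fac = knot_factor_root[OF assms(1,2) root x1]
      have v: "v j = c\<^sup>2 * (1 + t\<^sup>2)\<^sup>2 / (1 + t\<^sup>2)" using False by (simp only: v_def c_def Let_def if_False)
      then have v': "v j = c\<^sup>2 * (1 + t\<^sup>2)" using T_pos by (simp add: power2_eq_square)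
      have pos: "0 < root_norm (\<omega> ^ ?k) m" "0 < root_norm (\<omega> ^ ?k) (2 * m * n)"
        "0 < root_norm (\<omega> ^ ?k) 1" "0 < root_norm (\<omega> ^ ?k) (2 * m)"
      proof -
        have norm_pos: "0 < cmod (1 - y)" if "y \<noteq> 1" for y using that by simp
        show "0 < root_norm (\<omega> ^ ?k) m" "0 < root_norm (\<omega> ^ ?k) (2 * m * n)"
          "0 < root_norm (\<omega> ^ ?k) 1" "0 < root_norm (\<omega> ^ ?k) (2 * m)"
          unfolding root_norm_def power_one_right using fac(1-3) x1 by (blast intro: norm_pos)+
      qed
      then have c_pos: "0 < c" unfolding c_def by (intro divide_pos_pos mult_pos_pos)
      have "knot_factor m n (of_real t) (\<omega> ^ ?k) / (1 + (of_real t)\<^sup>2) = of_real (v j)"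
        unfolding fac(4)[of "of_real t"] c_def[symmetric] v by simp
      moreover have "0 < v j" unfolding v' using c_pos T_pos by simp
      moreover have "ln (v j) = u j"
      proof -
        have "ln (v j) = 2 * ln c + ln (1 + t\<^sup>2)"
          unfolding v' using c_pos T_pos by (simp add: ln_mult ln_realpow)
        also have "ln c = ln (root_norm (\<omega> ^ ?k) m) + ln (root_norm (\<omega> ^ ?k) (2 * m * n))
            - (ln (root_norm (\<omega> ^ ?k) 1) + ln (root_norm (\<omega> ^ ?k) (2 * m)))"
          unfolding c_def using pos by (simp add: ln_div ln_mult)
        also have "2 * (ln (root_norm (\<omega> ^ ?k) m) + ln (root_norm (\<omega> ^ ?k) (2 * m * n))
            - (ln (root_norm (\<omega> ^ ?k) 1) + ln (root_norm (\<omega> ^ ?k) (2 * m)))) + ln (1 + t\<^sup>2) = u j"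
        proof -
          have "(1 * ?k) mod q \<noteq> 0" using False by (simp only: mult_1 dvd_eq_mod_eq_0 not_False_eq_True)
          moreover have "2 * (A + B - (C + D)) + T = T - 2 * C + 2 * A + 2 * B - 2 * D" for A B C D T :: real
            by simp
          ultimately show ?thesis by (simp only: u_def h_def L_mult if_False)
        qed
        finally show ?thesis .
      qed
      ultimately show ?thesis by blast
    qed
    then show "knot_factor m n (of_real t) (\<omega> ^ ?k) / (1 + (of_real t)\<^sup>2) = of_real (v j)"
      "0 < v j" "ln (v j) = u j" by blast+
  qed

  have eval: "ln (rf_eval (twisted_alexander m n (2 * N) (sigma (2 * N) \<circ> \<rho>)) (of_real t)) / of_nat (2 * N)
      = of_real ((\<Sum>j<N. u j) / real N / 2)" for N
  proof -
    have "1 + (complex_of_real t)\<^sup>2 \<noteq> 0"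
    proof -
      have "1 + (complex_of_real t)\<^sup>2 = of_real (1 + t\<^sup>2)" by simp
      then show ?thesis using T_pos by (metis less_irrefl of_real_eq_0_iff)
    qed
    then have "rf_eval (twisted_alexander m n (2 * N) (sigma (2 * N) \<circ> \<rho>)) (of_real t)
        = (\<Prod>k<N. knot_factor m n (of_real t) (\<eta> N k) / (1 + (of_real t)\<^sup>2))"
      unfolding \<eta>_def by (rule lin_rep.rf_eval_twisted_alexander[OF rep, unfolded lin_rep.\<eta>_def[OF rep]])
    \<comment> \<open>The weights in \<open>\<eta>\<close> decrease from \<open>2 * N - 1\<close>
      while those in \<open>v\<close> increase from 1, so the index is reversed.\<close>
    also have "\<dots> = (\<Prod>k<N. of_real (v (N - Suc k)))"
    proof (rule prod.cong[OF HOL.refl])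
      fix k assume "k \<in> {..<N}"
      then have "2 * int N - 1 - 2 * int k = int (2 * (N - Suc k) + 1)" by simp
      then have "\<eta> N k = \<omega> ^ (2 * (N - Suc k) + 1)" unfolding \<eta>_def by (metis power_int_of_nat)
      then show "knot_factor m n (of_real t) (\<eta> N k) / (1 + (of_real t)\<^sup>2) = of_real (v (N - Suc k))"
        using factor by metis
    qed
    also have "\<dots> = (\<Prod>j<N. of_real (v j))"
      by (rule prod.nat_diff_reindex)
    finally have "ln (rf_eval (twisted_alexander m n (2 * N) (sigma (2 * N) \<circ> \<rho>)) (of_real t))
        = of_real (\<Sum>j<N. u j)"
      using ln_prod_of_real[of N v] v_pos ln_v by simp
    then show ?thesis by simp
  qed

  \<comment> \<open>\<open>4 * m * n\<close> is the successor of \<open>M\<close>, hence coprime to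
    \<open>M\<close>; this passes to their divisors \<open>2 * s\<close> and
    \<open>q\<close>.\<close>
  have coprime_q: "coprime (2 * s) q" if "2 * s dvd 4 * m * n" for s
  proof (rule coprime_divisors[OF that q_dvd])
    show "coprime (4 * m * n) M" unfolding M(1) by (rule coprime_Suc_left_nat)
  qed
  \<comment> \<open>Each multiplier permutes the residues, so all four give the same sum of
    \<open>L\<close>. The hidden \<open>- 2 * L\<close> in \<open>h\<close> makes the total
    coefficient 0.\<close>
  have "(\<Sum>j<q. u j) = sum h {..<q} + 2 * sum L {..<q} + 2 * sum L {..<q} - 2 * sum L {..<q}"
  proof -
    have d: "2 * 1 dvd 4 * m * n" "2 * m dvd 4 * m * n" "2 * (2 * m * n) dvd 4 * m * n" "2 * (2 * m) dvd 4 * m * n"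
      by (simp_all add: dvd_def)
    show ?thesis
      unfolding u_def sum.distrib sum_subtractf sum_distrib_left[symmetric]
        sum_odd_multiples_mod[OF q0 coprime_q[OF d(1)]] sum_odd_multiples_mod[OF q0 coprime_q[OF d(2)]]
        sum_odd_multiples_mod[OF q0 coprime_q[OF d(3)]] sum_odd_multiples_mod[OF q0 coprime_q[OF d(4)]] ..
  qed
  also have "sum h {..<q} = (\<Sum>r<q. if r = 0 then ln S - ln (1 + t\<^sup>2) else ln (1 + t\<^sup>2)) - 2 * sum L {..<q}"
  proof -
    have "sum h {..<q} = (\<Sum>r<q. (if r = 0 then ln S - ln (1 + t\<^sup>2) else ln (1 + t\<^sup>2)) - 2 * L r)"
      by (rule sum.cong) (simp_all add: h_def)
    then show ?thesis by (simp only: sum_subtractf sum_distrib_left)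
  qed
  \<comment> \<open>Exactly one residue is exceptional; it deviates from the common value by
    \<open>ln S - 2 * ln (1 + t\<^sup>2)\<close>, and this is the source of the term with
    \<open>1 / (2 * q)\<close>.\<close>
  also have "(\<Sum>r<q. if r = 0 then ln S - ln (1 + t\<^sup>2) else ln (1 + t\<^sup>2)) = ln S - 2 * ln (1 + t\<^sup>2) + real q * ln (1 + t\<^sup>2)"
  proof -
    have "(\<Sum>r<q. if r = 0 then ln S - ln (1 + t\<^sup>2) else ln (1 + t\<^sup>2)) =
        (\<Sum>r<q. ln (1 + t\<^sup>2) + (if r = 0 then ln S - 2 * ln (1 + t\<^sup>2) else 0))"
      by (rule sum.cong) auto
    also have "\<dots> = ln S - 2 * ln (1 + t\<^sup>2) + real q * ln (1 + t\<^sup>2)"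
      using q0 by (simp add: sum.distrib)
    finally show ?thesis .
  qed
  finally have period_sum: "(\<Sum>j<q. u j) = ln S - 2 * ln (1 + t\<^sup>2) + real q * ln (1 + t\<^sup>2)" by simp

  have "u (j + q) = u j" for j
  proof -
    have "(s * (2 * (j + q) + 1)) mod q = (s * (2 * j + 1)) mod q" for s
    proof -
      have eq: "s * (2 * (j + q) + 1) = s * (2 * j + 1) + q * (2 * s)" by (simp add: algebra_simps)
      show ?thesis unfolding eq by (rule mod_mult_self2)
    qed
    then show ?thesis by (simp only: u_def)
  qed
  then have "(\<lambda>N. (\<Sum>j<N. u j) / real N) \<longlonglongrightarrow> (\<Sum>j<q. u j) / real q"
    by (rule periodic_mean[OF q0])
  then have "(\<lambda>N. (\<Sum>j<N. u j) / real N / 2) \<longlonglongrightarrow> (\<Sum>j<q. u j) / real q / 2"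
    by (rule tendsto_divide[OF _ tendsto_const]) simp
  then have "(\<lambda>N. of_real ((\<Sum>j<N. u j) / real N / 2) :: complex) \<longlonglongrightarrow> of_real ((\<Sum>j<q. u j) / real q / 2)"
    by (rule tendsto_of_real)
  moreover have "(\<Sum>j<q. u j) / real q / 2 = 1 / (2 * real q) *
              ln (((real m)\<^sup>2 * (real n)\<^sup>2 * t ^ 4
                   + (2 * (real m)\<^sup>2 * (real n)\<^sup>2 - 4 * real m * real n + 1) * t\<^sup>2
                   + (real m)\<^sup>2 * (real n)\<^sup>2) / (t\<^sup>2 + 1)\<^sup>2)
            + 1 / 2 * ln (t\<^sup>2 + 1)"
  proof -
    \<comment> \<open>Expanding the two squares in \<open>S\<close> gives the quartic of the
      claim.\<close>
    have "(real m)\<^sup>2 * (real n)\<^sup>2 * t ^ 4 + (2 * (real m)\<^sup>2 * (real n)\<^sup>2 - 4 * real m * real n + 1) * t\<^sup>2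
        + (real m)\<^sup>2 * (real n)\<^sup>2 = S"
      by (simp add: S_def algebra_simps power2_eq_square power4_eq_xxxx)
    moreover have "ln (S / (t\<^sup>2 + 1)\<^sup>2) = ln S - 2 * ln (1 + t\<^sup>2)"
      using S_pos T_pos by (simp add: ln_div ln_realpow add.commute)
    ultimately show ?thesis
      unfolding period_sum using q0 by (simp add: field_simps)
  qed
  ultimately show ?thesis unfolding eval by (simp only:)
qed

end
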